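(* Consider the nondeterministic mixed Hegselmann--Krause model (with either pair interaction or group interaction) described in the context. Assume that $$0\le \limsup_{t\to\infty}\ \sup\{\alpha_i(t): i\in[n]\text{ and }\alpha_i(t)<1\}<1\quad\text{almost surely}.$$ Then for every $\delta>0$, all components of the profile are $\delta$-trivial in finite time almost surely, i.e. $$\tau_\delta:=\inf\{t\ge 0:\ \text{all connected components of } \tilde G(t)\cap\mathscr G(t)\text{ are }\delta\text{-trivial}\}<\infty\quad\text{almost surely}.$$
   Context: Model. Fix integers $n,d\ge 1$, a confidence threshold $\epsilon>0$, and a set of agents $[n]=\{1,\dots,n\}$. Time is discrete, $t=0,1,2,\dots$. Agent $i$ has opinion $x_i(t)\in\mathbf R^d$ at time $t$, with given initial opinions $x_i(0)$; $\|\cdot\|$ is the Euclidean norm. $\alpha_i(t)\in[0,1]$ is the degree of stubbornness of agent $i$ at time $t$. All random variables live on a probability space $(\Omega,\mathscr F,P)$. Graphs. All graphs are undirected with vertex set $[n]$; edges $(i,j)$ and $(j,i)$ are identified. - The social graph at time $t$ is a given graph $G(t)=([n],E(t))$, which may vary with $t$; $(i,j)\in E(t)$ means $i$ and $j$ are socially connected. - The social graph for update is a subgraph $\tilde G(t)=([n],\tilde E(t))$ of $G(t)$, specified below. - The opinion graph is $\mathscr G(t)=([n],\mathscr E(t))$ with $\mathscr E(t)=\{(i,j): i\ne j,\ \|x_i(t)-x_j(t)\|\le\epsilon\}$. - The profile at time $t$ is $\tilde G(t)\cap\mathscr G(t)$, with vertex set $[n]$ and edge set $\tilde E(t)\cap\mathscr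 E(t)$. - For $\delta>0$, the opinion graph, or a connected component of the profile, at time $t$ is $\delta$-trivial if $\|x_i(t)-x_j(t)\|\le\delta$ for any two of its vertices $i,j$; otherwise it is $\delta$-nontrivial. - A matching in a graph is a set of pairwise nonadjacent edges, none of which are loops. Random assumptions. For each $i\in[n]$, the $\alpha_i(t)$, $t\ge0$, are independent and identically distributed random variables on $[0,1]$. The $U_t$, $t\ge 0$, are independent and identically distributed random variables with (finite) support $S$, as follows. - Group interaction: $U_t=\{i\in[n]:\alpha_i(t)<1\}$, $S\subset\mathscr P([n])$ (the power set of $[n]$), every agent $i\in[n]$ belongs to some $a\in S$, and $\tilde E(t)=E(t)$. - Pair interaction: $U_t$ is the set of pairs selected to interact at time $t$; it takes values in $S\subset\{\text{matchings in }G(0)\}$, every $(i,j)\in U_t$ satisfies $\alpha_i(t)<1$ or $\alpha_j(t)<1$, and $\tilde E(t)=U_t\cap E(t)$. Update rule. For all $i\in[n]$ and $t\ge 0$, $$x_i(t+1)=\alpha_i(t)x_i(t)+\frac{1-\alpha_i(t)}{|\mathscr N_i(t)|}\sum_{k\in\mathscr N_i(t)}x_k(t),\qquad \mathscr N_i(t)=\{i\}\cup\{j\in[n]:(i,j)\in\tilde E(t)\cap\mathscr E(t)\}.$$ Convention: suprema of subsets of $[0,1]$ are taken in $[0,1]$, so $\sup\emptyset=0$.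
   Formalization: For group interaction, the vectors (α_1(t),…,α_n(t)), t≥0, are additionally assumed independent over time; if only each α_i and U_t are separately i.i.d., the claim fails, since one agent's stubbornness can foretell who moves next. *)

theory Defs
  imports "HOL-Probability.Probability"
begin

text \<open>
  Agents are the elements of a finite type \<open>'n\<close> and opinions live in \<open>real ^ 'd\<close>.
  An undirected graph on \<open>'n\<close> is given by its set of edges; the edge between \<open>i\<close> and \<open>j\<close>
  is the set \<open>{i, j}\<close>, so that \<open>(i, j)\<close> and \<open>(j, i)\<close> are identified and a loop is a singleton.
\<close>

definition edge_set :: "'n set set \<Rightarrow> bool" where
  "edge_set E \<longleftrightarrow> E \<subseteq> {{i, j} | i j. True}"

definition matching_in :: "'n set set \<Rightarrow> 'n set set \<Rightarrow> bool" where
  "matching_in E m \<longleftrightarrow> m \<subseteq> E \<and> (\<forall>e\<in>m. card e = 2) \<and> pairwise disjnt m"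

definition connected_components :: "'n set set \<Rightarrow> 'n set set" where
  "connected_components E = UNIV // ({(i, j). {i, j} \<in> E}\<^sup>*)"

definition opinion_graph :: "real \<Rightarrow> ('n \<Rightarrow> real ^ 'd) \<Rightarrow> 'n set set" where
  "opinion_graph \<epsilon> y = {{i, j} | i j. i \<noteq> j \<and> norm (y i - y j) \<le> \<epsilon>}"

definition profile :: "real \<Rightarrow> 'n set set \<Rightarrow> ('n \<Rightarrow> real ^ 'd) \<Rightarrow> 'n set set" where
  "profile \<epsilon> Eu y = Eu \<inter> opinion_graph \<epsilon> y"

definition neighborhood :: "real \<Rightarrow> 'n set set \<Rightarrow> ('n \<Rightarrow> real ^ 'd) \<Rightarrow> 'n \<Rightarrow> 'n set" where
  "neighborhood \<epsilon> Eu y i = insert i {j. {i, j} \<in> profile \<epsilon> Eu y}"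

definition trivial_on :: "real \<Rightarrow> ('n \<Rightarrow> real ^ 'd) \<Rightarrow> 'n set \<Rightarrow> bool" where
  "trivial_on \<delta> y C \<longleftrightarrow> (\<forall>i\<in>C. \<forall>j\<in>C. norm (y i - y j) \<le> \<delta>)"

definition HK_update ::
  "real \<Rightarrow> 'n set set \<Rightarrow> ('n \<Rightarrow> real) \<Rightarrow> ('n \<Rightarrow> real ^ 'd) \<Rightarrow> 'n \<Rightarrow> real ^ 'd" where
  "HK_update \<epsilon> Eu a y i =
     a i *\<^sub>R y i +
     ((1 - a i) / real (card (neighborhood \<epsilon> Eu y i))) *\<^sub>R (\<Sum>k\<in>neighborhood \<epsilon> Eu y i. y k)"

definition iid :: "'w measure \<Rightarrow> 'b measure \<Rightarrow> (nat \<Rightarrow> 'w \<Rightarrow> 'b) \<Rightarrow> bool" where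
  "iid M N X \<longleftrightarrow>
     prob_space.indep_vars M (\<lambda>_. N) X UNIV \<and> (\<forall>t. distr M N (X t) = distr M N (X 0))"

definition discrete_support :: "'w measure \<Rightarrow> ('w \<Rightarrow> 'b) \<Rightarrow> 'b set" where
  "discrete_support M X = {a. measure M {\<omega> \<in> space M. X \<omega> = a} > 0}"

text \<open>
  In both interactions \<open>E t\<close> is the social graph, \<open>Eu t \<omega>\<close> the social graph for update and
  \<open>\<alpha> i t\<close> the stubbornness of agent \<open>i\<close>.

  Under group interaction independence over time is required of the vectors of all \<open>\<alpha> i t\<close> and
  not just of each \<open>\<alpha> i\<close> and of \<open>U\<close> separately: with the latter alone, the values of
  one agent's stubbornness could reveal which agents are going to move at the next time.
\<close>

definition group_interaction ::
  "'w measure \<Rightarrow> ('n::finite \<Rightarrow> nat \<Rightarrow> 'w \<Rightarrow> real) \<Rightarrow> (nat \<Rightarrow> 'n set set) \<Rightarrow>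
   (nat \<Rightarrow> 'w \<Rightarrow> 'n set) \<Rightarrow> 'n set set \<Rightarrow> (nat \<Rightarrow> 'w \<Rightarrow> 'n set set) \<Rightarrow> bool" where
  "group_interaction M \<alpha> E U S Eu \<longleftrightarrow>
     prob_space.indep_vars M (\<lambda>_. PiM UNIV (\<lambda>_. borel)) (\<lambda>t \<omega> i. \<alpha> i t \<omega>) UNIV \<and>
     iid M (count_space UNIV) U \<and>
     (\<forall>t. discrete_support M (U t) = S) \<and>
     (\<forall>t. \<forall>\<omega>\<in>space M. U t \<omega> = {i. \<alpha> i t \<omega> < 1}) \<and>
     (\<forall>i. \<exists>a\<in>S. i \<in> a) \<and>
     (\<forall>t. \<forall>\<omega>\<in>space M. Eu t \<omega> = E t)"

definition pair_interaction ::
  "'w measure \<Rightarrow> ('n::finite \<Rightarrow> nat \<Rightarrow> 'w \<Rightarrow> real) \<Rightarrow> (nat \<Rightarrow> 'n set set) \<Rightarrow>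
   (nat \<Rightarrow> 'w \<Rightarrow> 'n set set) \<Rightarrow> 'n set set set \<Rightarrow> (nat \<Rightarrow> 'w \<Rightarrow> 'n set set) \<Rightarrow> bool" where
  "pair_interaction M \<alpha> E U S Eu \<longleftrightarrow>
     iid M (count_space UNIV) U \<and>
     (\<forall>t. discrete_support M (U t) = S) \<and>
     (\<forall>m\<in>S. matching_in (E 0) m) \<and>
     (\<forall>t. AE \<omega> in M. U t \<omega> \<in> S) \<and>
     (\<forall>t. AE \<omega> in M. \<forall>i j. {i, j} \<in> U t \<omega> \<longrightarrow> \<alpha> i t \<omega> < 1 \<or> \<alpha> j t \<omega> < 1) \<and>
     (\<forall>t. \<forall>\<omega>\<in>space M. Eu t \<omega> = U t \<omega> \<inter> E t)"

text \<open>The supremum is taken in the interval from 0 to 1, where the empty set has supremum 0.\<close>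

definition sup_nonstubborn :: "('n \<Rightarrow> nat \<Rightarrow> 'w \<Rightarrow> real) \<Rightarrow> nat \<Rightarrow> 'w \<Rightarrow> real" where
  "sup_nonstubborn \<alpha> t \<omega> = Sup (insert 0 {\<alpha> i t \<omega> | i. \<alpha> i t \<omega> < 1})"

definition hitting_time ::
  "real \<Rightarrow> real \<Rightarrow> (nat \<Rightarrow> 'w \<Rightarrow> 'n set set) \<Rightarrow> ('n \<Rightarrow> nat \<Rightarrow> 'w \<Rightarrow> real ^ 'd) \<Rightarrow> 'w \<Rightarrow> enat" where
  "hitting_time \<delta> \<epsilon> Eu x \<omega> =
     Inf {enat t | t. \<forall>C\<in>connected_components (profile \<epsilon> (Eu t \<omega>) (\<lambda>i. x i t \<omega>)).
                        trivial_on \<delta> (\<lambda>i. x i t \<omega>) C}"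

end

theory Submission
  imports Defs
begin

text \<open>
  The two kinds of interaction are settled by different arguments.

  Group interaction. Since agents may be fully stubborn at times, the averaging is symmetric only
  on average over the randomness, and in general neither the mean nor the variance of the opinions
  is monotone, even in expectation. Instead, each coordinate \<open>y\<close> of the opinions is measured by the
  ordered potential \<open>\<Sum>\<^sub>k \<beta>\<^sup>k y\<^sub>(\<^sub>k\<^sub>)\<close>, where \<open>y\<^sub>(\<^sub>0\<^sub>) \<le> y\<^sub>(\<^sub>1\<^sub>) \<le> \<dots>\<close> are the values in
  increasing order and \<open>\<beta>\<close> is small: raising a low value outweighs lowering all higher ones.
  The potential is a minimum of linear functionals, and it is additive along the decomposition of
  \<open>y\<close> into indicator functions of its superlevel sets (\<open>layer_decomposition\<close>,
  \<open>potential_le_layers\<close>). Therefore it suffices to see what averaging does to an indicator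
  function, that is, to a cut of the agents into a lower and an upper side. A cut without crossing
  edges is left alone. If some edge crosses, its lower endpoint moves with probability bounded
  below, and the weight it then wins, even multiplied by this probability, exceeds all that can be
  lost above (\<open>potential_averaged_ge\<close>).
  The opinions are independent of the present stubbornness, so the expected potential grows by
  a fixed multiple of the expected gap of the crossed cuts (\<open>expected_potential_increase\<close>).
  Being bounded, it cannot do so forever, and the crossed gaps control the diameters
  of the components (\<open>AE_crossing_gaps_small\<close>, \<open>trivial_on_components_if_crossing_gap\<close>).

  Pair interaction. The stubbornness may depend on the matchings of later times, so the opinions
  need not be independent of the next matching and the argument is pathwise. While one and the
  same matching \<open>m\<close> is selected, each of its pairs interacts only within itself: its distance
  never grows, and every interaction shrinks it by a factor bounded away from 1. A component that is not \<open>\<delta>\<close>-trivial costs a fixed amount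
  of the sum of the truncated distances, so it cannot occur at every time of a long run of \<open>m\<close>
  (\<open>constant_matching_run_hits\<close>). The limit superior makes the factor uniform from some time on,
  and independence of the selected matchings provides runs of every length after every time
  (\<open>AE_constant_run\<close>).
\<close>

section \<open>Cuts, layers and the ordered potential\<close>

definition cuts :: "'n::finite set set" where
  "cuts = {Z. Z \<noteq> {} \<and> Z \<noteq> UNIV}"

text \<open>
  For a proper nonempty \<open>Z\<close> this is the length of the interval of levels \<open>s\<close> with
  \<open>{i. y i \<le> s} = Z\<close>; it vanishes unless \<open>Z\<close> is a sublevel set of \<open>y\<close>. Indexing the layers
  of \<open>y\<close> by sets of agents, and not by rank, keeps the index set independent of \<open>y\<close>.
\<close>
definition gap :: "('n::finite \<Rightarrow> real) \<Rightarrow> 'n set \<Rightarrow> real" where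
  "gap y Z = max 0 (Min (y ` (- Z)) - Max (y ` Z))"

definition enumerations :: "'n::finite list set" where
  "enumerations = {l. distinct l \<and> set l = UNIV}"

text \<open>
  For \<open>0 \<le> \<beta> \<le> 1\<close> the value of the potential below at the indicator function of a set
  whose complement has \<open>m\<close> elements.
\<close>
definition tail_weight :: "'n::finite itself \<Rightarrow> real \<Rightarrow> nat \<Rightarrow> real" where
  "tail_weight _ \<beta> m = (\<Sum>k\<in>{m..<CARD('n)}. \<beta> ^ k)"

text \<open>
  For \<open>0 \<le> \<beta> \<le> 1\<close> the minimum is attained by the increasing order, so this is
  \<open>y\<^sub>(\<^sub>0\<^sub>) + \<beta> y\<^sub>(\<^sub>1\<^sub>) + \<beta>\<^sup>2 y\<^sub>(\<^sub>2\<^sub>) + \<dots>\<close> for the order statistics. As a minimum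
  of linear functionals it is superadditive, which is what reduces all estimates to indicator
  functions.
\<close>
definition potential :: "real \<Rightarrow> ('n::finite \<Rightarrow> real) \<Rightarrow> real" where
  "potential \<beta> y = Min ((\<lambda>l. \<Sum>k<CARD('n). \<beta> ^ k * y (l ! k)) ` enumerations)"

lemma finite_enumerations: "finite (enumerations :: 'n::finite list set)"
  using finite_subset_distinct[of "UNIV :: 'n set"]
  by (rule rev_finite_subset) (auto simp: enumerations_def)

lemma enumeration_bij:
  assumes "l \<in> (enumerations :: 'n::finite list set)"
  shows "bij_betw (\<lambda>k. l ! k) {..<CARD('n)} UNIV" "length l = CARD('n)"
proof -
  show len: "length l = CARD('n)"
    using assms distinct_card[of l] by (auto simp: enumerations_def)
  show "bij_betw (\<lambda>k. l ! k) {..<CARD('n)} UNIV"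
    using bij_betw_nth[of l "{..<CARD('n)}" UNIV] assms len by (auto simp: enumerations_def)
qed

lemma enumeration_index:
  assumes "l \<in> (enumerations :: 'n::finite list set)"
  obtains k where "k < CARD('n)" "b = l ! k"
  using bij_betw_imp_surj_on[OF enumeration_bij(1)[OF assms]] by blast

lemma enumeration_image_indices:
  fixes Z :: "'n::finite set"
  assumes "l \<in> enumerations"
  shows "(!) l ` {k. k < CARD('n) \<and> l ! k \<in> Z} = Z"
proof
  show "Z \<subseteq> (!) l ` {k. k < CARD('n) \<and> l ! k \<in> Z}"
  proof
    fix b assume "b \<in> Z"
    moreover obtain k where "k < CARD('n)" "b = l ! k" using enumeration_index[OF assms] .
    ultimately show "b \<in> (!) l ` {k. k < CARD('n) \<and> l ! k \<in> Z}" by blast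
  qed
qed blast

lemma ex_sorted_enumeration:
  fixes y :: "'n::finite \<Rightarrow> real"
  shows "\<exists>l\<in>enumerations. sorted (map y l)"
proof -
  obtain xs where "set xs = (UNIV :: 'n set)" "distinct xs"
    using finite_distinct_list[of "UNIV :: 'n set"] by auto
  then show ?thesis
    by (intro bexI[of _ "sort_key y xs"]) (auto simp: enumerations_def)
qed

lemma gap_nonneg: "0 \<le> gap y Z"
  by (simp add: gap_def)

lemma gap_pos_less:
  fixes y :: "'n::finite \<Rightarrow> real"
  assumes "gap y Z > 0" "i \<in> Z" "j \<notin> Z"
  shows "y i < y j"
proof -
  have "Max (y ` Z) < Min (y ` (-Z))" using assms(1) by (simp add: gap_def max_def split: if_splits)
  moreover have "y i \<le> Max (y ` Z)" using assms by simp
  moreover have "Min (y ` (-Z)) \<le> y j" using assms by simp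
  ultimately show ?thesis by linarith
qed

lemma down_closed_nat_set:
  fixes K :: "nat set"
  assumes "finite K" and down: "\<And>k k'. k \<in> K \<Longrightarrow> k' \<le> k \<Longrightarrow> k' \<in> K"
  shows "K = {..<card K}"
proof (cases "K = {}")
  case False
  define N where "N = Max K"
  have "N \<in> K" and le: "\<And>k. k \<in> K \<Longrightarrow> k \<le> N"
    using Max_in[OF assms(1) False] Max_ge[OF assms(1)] by (simp_all add: N_def)
  have eq: "K = {..N}"
    using down[OF \<open>N \<in> K\<close>] le by blast
  show ?thesis unfolding eq by (simp add: lessThan_Suc_atMost)
qed simp

text \<open>
  A set with a positive gap lies strictly below its complement, so it occupies an initial segment
  of every increasing enumeration.
\<close>
lemma gap_pos_indices:
  fixes y :: "'n::finite \<Rightarrow> real"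
  assumes l: "l \<in> enumerations" "sorted (map y l)" and g: "gap y Z > 0"
  shows "{k. k < CARD('n) \<and> l ! k \<in> Z} = {..<card Z}"
proof -
  define K where "K = {k. k < CARD('n) \<and> l ! k \<in> Z}"
  note bij = enumeration_bij[OF l(1)]
  have inj: "inj_on ((!) l) K"
    using bij(1) by (auto simp: K_def bij_betw_def intro: inj_on_subset)
  have "((!) l) ` K = Z"
    unfolding K_def by (rule enumeration_image_indices[OF l(1)])
  then have card: "card K = card Z" using card_image[OF inj] by simp
  have "K = {..<card K}"
  proof (rule down_closed_nat_set)
    show "finite K" by (simp add: K_def)
    fix k k' assume k: "k \<in> K" "k' \<le> k"
    have "y (l ! k') \<le> y (l ! k)"
      using l(2) k bij(2) by (auto simp: K_def sorted_iff_nth_mono)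
    then have "l ! k' \<in> Z" using gap_pos_less[OF g, of "l!k" "l!k'"] k by (force simp: K_def)
    then show "k' \<in> K" using k by (simp add: K_def)
  qed
  then show ?thesis using card by (simp add: K_def)
qed

lemma gap_prefix:
  fixes y :: "'n::finite \<Rightarrow> real"
  assumes l: "l \<in> enumerations" "sorted (map y l)" and m: "1 \<le> m" "m < CARD('n)"
  shows "gap y (set (take m l)) = y (l ! m) - y (l ! (m - 1))"
proof -
  have len: "length l = CARD('n)" using enumeration_bij[OF l(1)] by simp
  have compl: "- set (take m l) = set (drop m l)"
  proof -
    have "set (take m l) \<union> set (drop m l) = set l"
      by (simp flip: set_append)
    moreover have "set l = UNIV" "distinct l" using l(1) by (simp_all add: enumerations_def)
    moreover have "set (take m l) \<inter> set (drop m l) = {}"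
      using \<open>distinct l\<close> by (rule set_take_disj_set_drop_if_distinct) simp
    ultimately show ?thesis by blast
  qed
  have mono: "y (l ! i) \<le> y (l ! j)" if "i \<le> j" "j < CARD('n)" for i j
    using l(2) that len by (auto simp: sorted_iff_nth_mono)
  have "Max (y ` set (take m l)) = y (l ! (m - 1))"
  proof (rule Max_eqI)
    fix z assume "z \<in> y ` set (take m l)"
    then obtain i where "i < m" "z = y (l ! i)" using m len by (auto simp: in_set_conv_nth)
    then show "z \<le> y (l ! (m - 1))" using m mono[of i "m-1"] by auto
  next
    show "y (l ! (m - 1)) \<in> y ` set (take m l)"
      using m len by (intro imageI) (auto simp: in_set_conv_nth intro!: exI[of _ "m-1"])
  qed simp
  moreover have "Min (y ` (- set (take m l))) = y (l ! m)"
    unfolding compl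
  proof (rule Min_eqI)
    fix z assume "z \<in> y ` set (drop m l)"
    then obtain i where "i < CARD('n) - m" "z = y (l ! (m + i))" using m len by (auto simp: in_set_conv_nth)
    then show "y (l ! m) \<le> z" using m mono[of m "m+i"] by auto
  next
    show "y (l ! m) \<in> y ` set (drop m l)"
      using m len by (intro imageI) (auto simp: in_set_conv_nth intro!: exI[of _ 0])
  qed simp
  ultimately show ?thesis using mono[of "m-1" m] m by (simp add: gap_def)
qed

text \<open>
  Only the initial segments of an increasing enumeration have a nonzero gap, and distinct segments
  have distinct cardinalities, so a sum over all cuts collapses to a sum over ranks.
\<close>
lemma sum_gap_prefixes:
  fixes y :: "'n::finite \<Rightarrow> real" and \<phi> :: "'n set \<Rightarrow> real"
  assumes l: "l \<in> enumerations" "sorted (map y l)"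
  shows "(\<Sum>Z\<in>cuts. gap y Z * \<phi> Z)
       = (\<Sum>m\<in>{1..<CARD('n)}. (y (l ! m) - y (l ! (m - 1))) * \<phi> (set (take m l)))"
proof -
  note len = enumeration_bij(2)[OF l(1)]
  have cardt: "card (set (take m l)) = m" if "m \<in> {1..<CARD('n)}" for m
    using distinct_card[of "take m l"] l(1) that len by (simp add: enumerations_def)
  have inj: "inj_on (\<lambda>m. set (take m l)) {1..<CARD('n)}"
    by (rule inj_on_inverseI[of _ card]) (rule cardt)
  have sub: "(\<lambda>m. set (take m l)) ` {1..<CARD('n)} \<subseteq> cuts"
  proof (intro image_subsetI)
    fix m assume m: "m \<in> {1..<CARD('n)}"
    have "set (take m l) \<noteq> {}" using cardt[OF m] m by force
    moreover have "set (take m l) \<noteq> UNIV" using cardt[OF m] m by force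
    ultimately show "set (take m l) \<in> cuts"
      unfolding cuts_def by simp
  qed
  have zero: "gap y Z = 0" if Z: "Z \<in> cuts - (\<lambda>m. set (take m l)) ` {1..<CARD('n)}" for Z
  proof (rule ccontr)
    assume "gap y Z \<noteq> 0"
    then have g: "gap y Z > 0" using gap_nonneg[of y Z] by linarith
    have c: "card Z \<in> {1..<CARD('n)}"
      using Z psubset_card_mono[of UNIV Z] by (simp add: cuts_def Suc_le_eq card_gt_0_iff psubset_eq)
    have "Z = (!) l ` {k. k < CARD('n) \<and> l ! k \<in> Z}"
      using enumeration_image_indices[OF l(1), of Z] by simp
    also have "\<dots> = set (take (card Z) l)"
      unfolding gap_pos_indices[OF l g] lessThan_atLeast0 using c len by (intro nth_image) auto
    finally show False using Z c by blast
  qed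
  have "(\<Sum>Z\<in>cuts. gap y Z * \<phi> Z) = (\<Sum>Z\<in>(\<lambda>m. set (take m l)) ` {1..<CARD('n)}. gap y Z * \<phi> Z)"
    by (rule sum.mono_neutral_right) (use sub zero in auto)
  also have "\<dots> = (\<Sum>m\<in>{1..<CARD('n)}. gap y (set (take m l)) * \<phi> (set (take m l)))"
    by (subst sum.reindex[OF inj]) (simp add: o_def)
  also have "\<dots> = (\<Sum>m\<in>{1..<CARD('n)}. (y (l ! m) - y (l ! (m - 1))) * \<phi> (set (take m l)))"
    by (intro sum.cong refl) (simp add: gap_prefix[OF l])
  finally show ?thesis .
qed

text \<open>
  Along an increasing enumeration the sum telescopes from the minimum up to \<open>y b\<close>.
\<close>
lemma layer_decomposition:
  fixes y :: "'n::finite \<Rightarrow> real"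
  shows "y b = Min (range y) + (\<Sum>Z\<in>cuts. gap y Z * indicator (- Z) b)"
proof -
  obtain l where l: "l \<in> enumerations" "sorted (map y l)" using ex_sorted_enumeration[of y] by auto
  note bij = enumeration_bij[OF l(1)]
  obtain k where k: "k < CARD('n)" "b = l ! k"
    using enumeration_index[OF l(1)] .
  have mono: "y (l ! i) \<le> y (l ! j)" if "i \<le> j" "j < CARD('n)" for i j
    using l(2) that bij by (auto simp: sorted_iff_nth_mono)
  have mn: "Min (range y) = y (l ! 0)"
  proof (rule Min_eqI)
    fix z assume "z \<in> range y"
    then obtain i where "i < CARD('n)" "z = y (l ! i)"
      using enumeration_index[OF l(1)] by (metis imageE)
    then show "y (l ! 0) \<le> z" using mono by auto
  qed auto
  have ind: "indicator (- set (take m l)) b = (if m \<le> k then 1 else 0 :: real)" if "m < CARD('n)" for m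
  proof -
    have "b \<in> set (take m l) \<longleftrightarrow> k < m"
      using k that bij l(1) nth_eq_iff_index_eq[of l] by (fastforce simp: in_set_conv_nth enumerations_def)
    then show ?thesis by auto
  qed
  have "(\<Sum>Z\<in>cuts. gap y Z * indicator (- Z) b)
      = (\<Sum>m\<in>{1..<CARD('n)}. (y (l ! m) - y (l ! (m - 1))) * (if m \<le> k then 1 else 0))"
    unfolding sum_gap_prefixes[OF l] by (intro sum.cong refl) (simp add: ind)
  also have "\<dots> = (\<Sum>m\<in>{Suc 0..k}. (y (l ! m) - y (l ! (m - 1))))"
    by (rule sum.mono_neutral_cong_right) (use k in auto)
  also have "\<dots> = y (l ! k) - y (l ! 0)"
    using sum_telescope''[of 0 k "\<lambda>m. y (l ! m)"] by (simp add: atLeastSucAtMost_greaterThanAtMost)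
  finally show ?thesis using k mn by simp
qed

lemma weighted_sum_layers:
  fixes w :: "'a \<Rightarrow> real"
  shows "(\<Sum>k\<in>K. w k * (v + (\<Sum>Z\<in>C. g Z * f Z k)))
       = (\<Sum>k\<in>K. w k) * v + (\<Sum>Z\<in>C. g Z * (\<Sum>k\<in>K. w k * f Z k))"
proof -
  have "(\<Sum>k\<in>K. w k * (\<Sum>Z\<in>C. g Z * f Z k)) = (\<Sum>Z\<in>C. \<Sum>k\<in>K. w k * (g Z * f Z k))"
    unfolding sum_distrib_left by (rule sum.swap)
  then show ?thesis
    by (simp add: distrib_left sum.distrib sum_distrib_right sum_distrib_left mult.left_commute)
qed

text \<open>
  Evaluating the functional of one increasing enumeration gives the right-hand side exactly: each
  cut with a positive gap leaves the ranks from \<open>card Z\<close> upwards outside \<open>Z\<close>.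
\<close>
lemma potential_le_layers:
  fixes y :: "'n::finite \<Rightarrow> real"
  shows "potential \<beta> y \<le> (\<Sum>k<CARD('n). \<beta> ^ k) * Min (range y)
           + (\<Sum>Z\<in>cuts. gap y Z * tail_weight TYPE('n) \<beta> (card Z))"
proof -
  obtain l where l: "l \<in> enumerations" "sorted (map y l)" using ex_sorted_enumeration[of y] by auto
  have *: "gap y Z * (\<Sum>k<CARD('n). \<beta> ^ k * indicator (- Z) (l ! k))
         = gap y Z * tail_weight TYPE('n) \<beta> (card Z)" for Z
  proof (cases "gap y Z > 0")
    case True
    have ind: "l ! k \<in> Z \<longleftrightarrow> k < card Z" if "k < CARD('n)" for k
      using gap_pos_indices[OF l True] that by blast
    have "(\<Sum>k<CARD('n). \<beta> ^ k * indicator (- Z) (l ! k)) = tail_weight TYPE('n) \<beta> (card Z)"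
      unfolding tail_weight_def
      by (rule sum.mono_neutral_cong_right) (auto simp: ind)
    then show ?thesis by simp
  next
    case False
    then show ?thesis using gap_nonneg[of y Z] by (metis mult_zero_left order_le_less)
  qed
  have "potential \<beta> y \<le> (\<Sum>k<CARD('n). \<beta> ^ k * y (l ! k))"
    unfolding potential_def using l(1) by (intro Min_le) (auto simp: finite_enumerations)
  also have "\<dots> = (\<Sum>k<CARD('n). \<beta> ^ k * (Min (range y) + (\<Sum>Z\<in>cuts. gap y Z * indicator (- Z) (l ! k))))"
    by (intro sum.cong refl arg_cong2[of _ _ _ _ "(*)"] layer_decomposition)
  also have "\<dots> = (\<Sum>k<CARD('n). \<beta> ^ k) * Min (range y)
       + (\<Sum>Z\<in>cuts. gap y Z * (\<Sum>k<CARD('n). \<beta> ^ k * indicator (- Z) (l ! k)))"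
    by (rule weighted_sum_layers)
  finally show ?thesis by (simp only: *)
qed

text \<open>
  Among the index sets of a given size the final segment has the least sum, since the weights
  decrease.
\<close>
lemma sum_final_powers_le:
  fixes \<beta> :: real
  assumes "0 \<le> \<beta>" "\<beta> \<le> 1" "K \<subseteq> {..<n}" "n - m \<le> card K"
  shows "(\<Sum>k\<in>{m..<n}. \<beta> ^ k) \<le> (\<Sum>k\<in>K. \<beta> ^ k)"
proof -
  define T where "T = {m..<n}"
  have fin: "finite K" "finite T" using assms(3) finite_subset by (auto simp: T_def)
  have "card (T - K) \<le> card (K - T)"
    using card_Int_Diff[OF fin(1), of T] card_Int_Diff[OF fin(2), of K] assms(4)
    by (simp add: T_def Int_commute)
  then have "real (card (T - K)) * \<beta> ^ m \<le> real (card (K - T)) * \<beta> ^ m"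
    using assms(1) by (intro mult_right_mono) auto
  moreover have "(\<Sum>k\<in>T - K. \<beta> ^ k) \<le> real (card (T - K)) * \<beta> ^ m"
    using assms(1,2) by (intro sum_bounded_above) (auto simp: T_def power_decreasing)
  moreover have "real (card (K - T)) * \<beta> ^ m \<le> (\<Sum>k\<in>K - T. \<beta> ^ k)"
    using assms by (intro sum_bounded_below) (auto simp: T_def intro!: power_decreasing)
  moreover have "(\<Sum>k\<in>T. \<beta> ^ k) = (\<Sum>k\<in>T \<inter> K. \<beta> ^ k) + (\<Sum>k\<in>T - K. \<beta> ^ k)"
    by (rule sum.Int_Diff[OF fin(2)])
  moreover have "(\<Sum>k\<in>K. \<beta> ^ k) = (\<Sum>k\<in>T \<inter> K. \<beta> ^ k) + (\<Sum>k\<in>K - T. \<beta> ^ k)"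
    unfolding Int_commute[of T] by (rule sum.Int_Diff[OF fin(1)])
  ultimately show ?thesis unfolding T_def by linarith
qed

text \<open>
  A configuration that is at least \<open>\<theta>\<close> outside \<open>m\<close> agents carries at least the weight of
  the last \<open>CARD('n) - m\<close> ranks, whatever the order of the agents.
\<close>
lemma weighted_sum_ge_tail:
  fixes u :: "'n::finite \<Rightarrow> real"
  assumes l: "l \<in> enumerations" and \<beta>: "0 \<le> \<beta>" "\<beta> \<le> 1"
    and u: "\<And>i. 0 \<le> u i" and \<theta>: "0 \<le> \<theta>" and few: "card {i. u i < \<theta>} \<le> m"
  shows "\<theta> * tail_weight TYPE('n) \<beta> m \<le> (\<Sum>k<CARD('n). \<beta> ^ k * u (l ! k))"
proof -
  define K where "K = {k. k < CARD('n) \<and> l ! k \<in> {i. \<theta> \<le> u i}}"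
  have inj: "inj_on ((!) l) K"
    by (rule inj_on_subset[OF bij_betw_imp_inj_on[OF enumeration_bij(1)[OF l]]]) (auto simp: K_def)
  have "card K = card {i. \<theta> \<le> u i}"
    using card_image[OF inj] enumeration_image_indices[OF l, of "{i. \<theta> \<le> u i}"] by (simp add: K_def)
  also have "{i. \<theta> \<le> u i} = - {i. u i < \<theta>}" by auto
  also have "card \<dots> = CARD('n) - card {i. u i < \<theta>}" by (simp add: card_Diff_subset Compl_eq_Diff_UNIV)
  finally have "CARD('n) - m \<le> card K" using few by simp
  then have "tail_weight TYPE('n) \<beta> m \<le> (\<Sum>k\<in>K. \<beta> ^ k)"
    unfolding tail_weight_def by (intro sum_final_powers_le \<beta>) (auto simp: K_def)
  then have "\<theta> * tail_weight TYPE('n) \<beta> m \<le> (\<Sum>k\<in>K. \<beta> ^ k * \<theta>)"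
    using \<theta> by (simp add: mult_left_mono flip: sum_distrib_right) (simp add: mult.commute mult_left_mono)
  also have "\<dots> \<le> (\<Sum>k\<in>K. \<beta> ^ k * u (l ! k))"
    using \<beta> by (intro sum_mono mult_left_mono) (auto simp: K_def)
  also have "\<dots> \<le> (\<Sum>k<CARD('n). \<beta> ^ k * u (l ! k))"
    using \<beta> u by (intro sum_mono2) (auto simp: K_def)
  finally show ?thesis .
qed

section \<open>One averaging step\<close>

definition averaged ::
  "('n \<Rightarrow> 'n set) \<Rightarrow> ('n \<Rightarrow> real) \<Rightarrow> ('n \<Rightarrow> real) \<Rightarrow> 'n \<Rightarrow> real" where
  "averaged N a y i = a i * y i + ((1 - a i) / real (card (N i))) * (\<Sum>k\<in>N i. y k)"

text \<open>
  The agents of \<open>Z\<close> that are pulled out of \<open>Z\<close>: they have a neighbour on the other side of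
  the cut.
\<close>
definition lower_boundary :: "('n \<Rightarrow> 'n set) \<Rightarrow> 'n set \<Rightarrow> 'n set" where
  "lower_boundary N Z = {j \<in> Z. \<exists>i\<in>N j. i \<notin> Z}"

lemma averaged_const:
  fixes N :: "'n::finite \<Rightarrow> 'n set"
  assumes "i \<in> N i" "\<And>k. k \<in> N i \<Longrightarrow> y k = v"
  shows "averaged N a y i = v"
proof -
  have "card (N i) \<noteq> 0" using assms(1) by auto
  moreover have "(\<Sum>k\<in>N i. y k) = (\<Sum>k\<in>N i. v)" by (intro sum.cong refl assms(2))
  ultimately show ?thesis by (simp add: averaged_def assms(2)[OF assms(1)] field_simps)
qed

text \<open>
  Averaging is linear and fixes constants, so it acts on each layer separately.
\<close>
lemma averaged_layers:
  fixes y :: "'n::finite \<Rightarrow> real"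
  assumes "i \<in> N i"
  shows "averaged N a y i
       = Min (range y) + (\<Sum>Z\<in>cuts. gap y Z * averaged N a (indicator (- Z)) i)"
proof -
  have ne: "card (N i) \<noteq> 0" using assms by auto
  define q where "q = (1 - a i) / real (card (N i))"
  have q: "a i + q * real (card (N i)) = 1" using ne by (simp add: q_def)
  have "averaged N a y i = a i * (Min (range y) + (\<Sum>Z\<in>cuts. gap y Z * indicator (- Z) i))
      + q * (\<Sum>k\<in>N i. Min (range y) + (\<Sum>Z\<in>cuts. gap y Z * indicator (- Z) k))"
    unfolding averaged_def q_def by (simp only: layer_decomposition[of y, symmetric])
  also have "\<dots> = (a i + q * real (card (N i))) * Min (range y)
      + (\<Sum>Z\<in>cuts. gap y Z * (a i * indicator (- Z) i + q * (\<Sum>k\<in>N i. indicator (- Z) k)))"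
    by (simp add: distrib_left distrib_right sum.distrib sum_distrib_left mult_ac
        sum.swap[of _ cuts] del: sum_mult_indicator indicator_simps)
  finally show ?thesis unfolding q by (simp add: averaged_def q_def)
qed

context
  fixes N :: "'n::finite \<Rightarrow> 'n set" and a :: "'n \<Rightarrow> real"
  assumes refl_N: "\<And>i. i \<in> N i" and a01: "\<And>i. a i \<in> {0..1}"
begin

lemma averaged_ge_neighbor:
  assumes u: "\<And>i. 0 \<le> u i" and "j \<in> N i"
  shows "(1 - a i) / real CARD('n) * u j \<le> averaged N a u i"
proof -
  have c: "0 < card (N i)" "card (N i) \<le> CARD('n)"
    using refl_N[of i] by (auto simp: card_gt_0_iff intro!: card_mono)
  have "(1 - a i) / real CARD('n) * u j \<le> (1 - a i) / real (card (N i)) * (\<Sum>k\<in>N i. u k)"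
    using a01[of i] u c \<open>j \<in> N i\<close>
    by (intro mult_mono frac_le) (auto intro: member_le_sum)
  moreover have "0 \<le> a i * u i" using a01[of i] u by simp
  ultimately show ?thesis unfolding averaged_def by linarith
qed

lemma averaged_nonneg:
  assumes u: "\<And>i. 0 \<le> u i"
  shows "0 \<le> averaged N a u i"
  using a01[of i] u by (auto simp: averaged_def intro!: add_nonneg_nonneg mult_nonneg_nonneg sum_nonneg divide_nonneg_nonneg)

lemma averaged_ge_self:
  assumes u: "\<And>i. 0 \<le> u i"
  shows "u i / real CARD('n) \<le> averaged N a u i"
proof -
  have c: "0 < card (N i)" "card (N i) \<le> CARD('n)"
    using refl_N[of i] by (auto simp: card_gt_0_iff intro!: card_mono)
  have "(1 - a i) / real CARD('n) * u i \<le> (1 - a i) / real (card (N i)) * (\<Sum>k\<in>N i. u k)"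
    using a01[of i] u c refl_N
    by (intro mult_mono frac_le) (auto intro: member_le_sum)
  moreover have "a i * (u i / real CARD('n)) \<le> a i * u i"
    using a01[of i] u[of i] by (intro mult_left_mono) (auto simp: divide_le_eq mult_le_cancel_left1 Suc_leI)
  moreover have "u i / real CARD('n) = a i * (u i / real CARD('n)) + (1 - a i) / real CARD('n) * u i"
    by (simp add: field_simps)
  ultimately show ?thesis unfolding averaged_def by linarith
qed

text \<open>
  The estimate for a single cut, that is for the configuration which is 0 on \<open>Z\<close> and 1 elsewhere.
  If no edge crosses the cut, symmetry of the neighbourhoods makes the configuration a fixed point.
  Otherwise the total weight of the upper side may be lost; but when one boundary agent moves with
  stubbornness at most \<open>c\<close>, it rises to at least \<open>(1 - c) / CARD('n)\<close>, every agent of the upper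
  side stays above that level because each neighbourhood contains its own agent, and so the rank
  \<open>card Z - 1\<close>, whose weight exceeds all later ones together for small \<open>\<beta>\<close>, is won. The division by
  \<open>(real CARD('n))\<^sup>2\<close> and not by \<open>CARD('n)\<close> lets every boundary agent claim a share of this
  gain, so that the bound is a sum over agents.
\<close>
lemma averaged_cut_ge:
  fixes Z :: "'n set"
  assumes sym: "\<And>i j. i \<in> N j \<Longrightarrow> j \<in> N i"
    and \<beta>: "0 < \<beta>" "\<beta> \<le> 1" and c: "0 \<le> c" "c < 1" and l: "l \<in> enumerations"
  shows "tail_weight TYPE('n) \<beta> (card Z) +
           (\<Sum>j\<in>lower_boundary N Z.
              (if a j \<le> c then (1 - c) / (real CARD('n))\<^sup>2 * \<beta> ^ (card Z - 1) else 0)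
                - tail_weight TYPE('n) \<beta> (card Z))
       \<le> (\<Sum>k<CARD('n). \<beta> ^ k * averaged N a (indicator (- Z)) (l ! k))"
    (is "?\<tau> + (\<Sum>j\<in>?B. ?\<kappa> j - ?\<tau>) \<le> ?S")
proof -
  define u where "u = averaged N a (indicator (- Z) :: 'n \<Rightarrow> real)"
  have u0: "0 \<le> u i" for i unfolding u_def by (intro averaged_nonneg) simp
  have S: "?S = (\<Sum>k<CARD('n). \<beta> ^ k * u (l ! k))" by (simp add: u_def)
  have S0: "0 \<le> ?S" unfolding S using u0 \<beta> by (intro sum_nonneg mult_nonneg_nonneg) auto
  have tail0: "0 \<le> ?\<tau>" using \<beta> by (auto simp: tail_weight_def intro!: sum_nonneg)
  show ?thesis
  proof (cases "?B = {}")
    case True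
    have "u i = indicator (- Z) i" for i
    proof -
      have "i \<in> Z \<longleftrightarrow> k \<in> Z" if "k \<in> N i" for k
        using True that sym[OF that] by (auto simp: lower_boundary_def)
      then show ?thesis unfolding u_def
        by (intro averaged_const refl_N) (auto simp: indicator_def)
    qed
    then have "{i. u i < 1} = Z" by (auto simp: indicator_def split: if_splits)
    then have "1 * ?\<tau> \<le> ?S"
      unfolding S using \<beta> by (intro weighted_sum_ge_tail l u0) auto
    then show ?thesis using True by simp
  next
    case False
    then have "1 \<le> card ?B" by (simp add: Suc_le_eq card_gt_0_iff)
    then have "?\<tau> \<le> card ?B * ?\<tau>" using tail0 by (simp add: mult_le_cancel_right1)
    then have "?\<tau> + (\<Sum>j\<in>?B. ?\<kappa> j - ?\<tau>) \<le> (\<Sum>j\<in>?B. ?\<kappa> j)"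
      by (simp add: sum_subtractf)
    also have "\<dots> \<le> ?S"
    proof (cases "\<exists>j\<in>?B. a j \<le> c")
      case True
      then obtain j i where j: "j \<in> Z" "a j \<le> c" and i: "i \<in> N j" "i \<notin> Z"
        by (auto simp: lower_boundary_def)
      define \<theta> where "\<theta> = (1 - c) / real CARD('n)"
      have \<theta>: "0 \<le> \<theta>" using c by (simp add: \<theta>_def)
      \<comment> \<open>After the step at most \<open>card Z - 1\<close> agents remain below \<open>\<theta>\<close>.\<close>
      have "\<theta> \<le> u k" if "k \<in> insert j (- Z)" for k
      proof (cases "k = j")
        case True
        have "\<theta> \<le> (1 - a j) / real CARD('n) * indicator (- Z) i"
          using j i by (auto simp: \<theta>_def divide_right_mono)
        also have "\<dots> \<le> u j" unfolding u_def by (intro averaged_ge_neighbor i) simp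
        finally show ?thesis using True by simp
      next
        case False
        then have "k \<notin> Z" using that by simp
        then have "\<theta> \<le> indicator (- Z) k / real CARD('n)"
          using c by (auto simp: \<theta>_def divide_right_mono)
        also have "\<dots> \<le> u k" unfolding u_def by (intro averaged_ge_self) simp
        finally show ?thesis .
      qed
      then have "{k. u k < \<theta>} \<subseteq> Z - {j}" by force
      then have "card {k. u k < \<theta>} \<le> card (Z - {j})" by (intro card_mono) auto
      then have few: "card {k. u k < \<theta>} \<le> card Z - 1" using j by simp
      have Zpos: "0 < card Z" "card Z \<le> CARD('n)" using j by (auto simp: card_gt_0_iff intro: card_mono)
      have "(\<Sum>j\<in>?B. ?\<kappa> j) \<le> real (card ?B) * ((1 - c) / (real CARD('n))\<^sup>2 * \<beta> ^ (card Z - 1))"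
        using c \<beta> by (intro sum_bounded_above) auto
      also have "\<dots> \<le> real CARD('n) * ((1 - c) / (real CARD('n))\<^sup>2 * \<beta> ^ (card Z - 1))"
        using c \<beta> by (intro mult_right_mono) (auto intro: card_mono)
      also have "\<dots> = \<theta> * \<beta> ^ (card Z - 1)"
        by (simp add: \<theta>_def power2_eq_square)
      also have "\<dots> \<le> \<theta> * tail_weight TYPE('n) \<beta> (card Z - 1)"
        unfolding tail_weight_def using \<theta> \<beta> Zpos
        by (intro mult_left_mono member_le_sum[of _ _ "\<lambda>k. \<beta> ^ k"]) auto
      also have "\<dots> \<le> ?S"
        unfolding S using \<beta> by (intro weighted_sum_ge_tail l u0 \<theta> few) auto
      finally show ?thesis .
    next
      case False
      then have "(\<Sum>j\<in>?B. ?\<kappa> j) = 0" by (intro sum.neutral) auto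
      then show ?thesis using S0 by simp
    qed
    finally show ?thesis .
  qed
qed

text \<open>
  Superadditivity of the potential sums the estimates for single cuts. The right factor depends
  on the stubbornness of one agent and the gap only on the current opinions, which is the form
  in which independence can be used.
\<close>
lemma potential_averaged_ge:
  fixes y :: "'n \<Rightarrow> real"
  assumes sym: "\<And>i j. i \<in> N j \<Longrightarrow> j \<in> N i"
    and \<beta>: "0 < \<beta>" "\<beta> \<le> 1" and c: "0 \<le> c" "c < 1"
  shows "potential \<beta> y +
           (\<Sum>Z\<in>cuts. \<Sum>j\<in>lower_boundary N Z. gap y Z *
              ((if a j \<le> c then (1 - c) / (real CARD('n))\<^sup>2 * \<beta> ^ (card Z - 1) else 0)
                - tail_weight TYPE('n) \<beta> (card Z)))
       \<le> potential \<beta> (averaged N a y)" (is "_ + ?D \<le> _")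
proof -
  have "potential \<beta> y + ?D \<le> (\<Sum>k<CARD('n). \<beta> ^ k * averaged N a y (l ! k))"
    if l: "l \<in> enumerations" for l
  proof -
    define D where "D Z = (\<Sum>j\<in>lower_boundary N Z.
              (if a j \<le> c then (1 - c) / (real CARD('n))\<^sup>2 * \<beta> ^ (card Z - 1) else 0)
                - tail_weight TYPE('n) \<beta> (card Z))" for Z
    have "?D = (\<Sum>Z\<in>cuts. gap y Z * D Z)"
      unfolding D_def sum_distrib_left ..
    then have "potential \<beta> y + ?D \<le> (\<Sum>k<CARD('n). \<beta> ^ k) * Min (range y)
       + ((\<Sum>Z\<in>cuts. gap y Z * tail_weight TYPE('n) \<beta> (card Z)) + (\<Sum>Z\<in>cuts. gap y Z * D Z))"
      using potential_le_layers[of \<beta> y] by linarith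
    also have "\<dots> = (\<Sum>k<CARD('n). \<beta> ^ k) * Min (range y)
       + (\<Sum>Z\<in>cuts. gap y Z * (tail_weight TYPE('n) \<beta> (card Z) + D Z))"
      by (simp only: distrib_left sum.distrib)
    also have "\<dots> \<le> (\<Sum>k<CARD('n). \<beta> ^ k) * Min (range y)
       + (\<Sum>Z\<in>cuts. gap y Z * (\<Sum>k<CARD('n). \<beta> ^ k * averaged N a (indicator (- Z)) (l ! k)))"
      unfolding D_def
      by (intro add_left_mono sum_mono mult_left_mono averaged_cut_ge[OF _ \<beta> c l] gap_nonneg) (rule sym)
    also have "\<dots> = (\<Sum>k<CARD('n). \<beta> ^ k * (Min (range y)
        + (\<Sum>Z\<in>cuts. gap y Z * averaged N a (indicator (- Z)) (l ! k))))"
      by (rule weighted_sum_layers[symmetric])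
    also have "\<dots> = (\<Sum>k<CARD('n). \<beta> ^ k * averaged N a y (l ! k))"
      by (simp only: averaged_layers[of _ N a y, OF refl_N, symmetric])
    finally show ?thesis .
  qed
  moreover have "(enumerations :: 'n list set) \<noteq> {}" using ex_sorted_enumeration by blast
  ultimately show ?thesis
    unfolding potential_def[of _ "averaged N a y"]
    by (intro Min.boundedI) (auto simp: finite_enumerations)
qed

end

section \<open>Components of the profile\<close>

text \<open>
  The part of the increments of \<open>y\<close> that is crossed by edges, each cut being counted once for
  every agent on its lower boundary. It bounds the differences of \<open>y\<close> within a component.
\<close>
definition crossing_gap :: "('n::finite \<Rightarrow> 'n set) \<Rightarrow> ('n \<Rightarrow> real) \<Rightarrow> real" where
  "crossing_gap N y = (\<Sum>Z\<in>cuts. \<Sum>j\<in>lower_boundary N Z. gap y Z)"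

lemma neighborhood_refl: "i \<in> neighborhood \<epsilon> E y i"
  by (simp add: neighborhood_def)

lemma neighborhood_sym: "i \<in> neighborhood \<epsilon> E y j \<Longrightarrow> j \<in> neighborhood \<epsilon> E y i"
  by (auto simp: neighborhood_def insert_commute)

lemma HK_update_nth:
  "HK_update \<epsilon> E a y i $ k = averaged (neighborhood \<epsilon> E y) a (\<lambda>j. y j $ k) i"
  by (simp add: HK_update_def averaged_def)

lemma crossing_gap_nonneg: "0 \<le> crossing_gap N y"
  unfolding crossing_gap_def by (intro sum_nonneg gap_nonneg)

text \<open>
  A path between two agents crosses every cut that separates them, and the gaps of the separating
  cuts add up to the difference of the two values.
\<close>
lemma difference_le_crossing_gap:
  fixes y :: "'n::finite \<Rightarrow> real"
  assumes conn: "(a, b) \<in> {(i, j). i \<in> N j}\<^sup>*"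
  shows "y a - y b \<le> crossing_gap N y"
proof -
  have "y a - y b = (\<Sum>Z\<in>cuts. gap y Z * (indicator (- Z) a - indicator (- Z) b))"
    using layer_decomposition[of y a] layer_decomposition[of y b]
    by (simp add: right_diff_distrib sum_subtractf)
  also have "\<dots> \<le> (\<Sum>Z\<in>cuts. gap y Z * real (card (lower_boundary N Z)))"
  proof (intro sum_mono mult_left_mono gap_nonneg)
    fix Z :: "'n set"
    show "indicator (- Z) a - indicator (- Z) b \<le> real (card (lower_boundary N Z))"
    proof (cases "a \<notin> Z \<and> b \<in> Z")
      case True
      have "lower_boundary N Z \<noteq> {}" if "a \<notin> Z" "b \<in> Z"
        using conn that
      proof (induction rule: rtrancl_induct)
        case (step i j)
        then show ?case by (auto simp: lower_boundary_def)
      qed simp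
      then have "1 \<le> card (lower_boundary N Z)"
        using True by (simp add: Suc_le_eq card_gt_0_iff)
      then show ?thesis using True by simp
    qed (auto simp: indicator_def)
  qed
  also have "\<dots> = crossing_gap N y"
    by (simp add: crossing_gap_def mult.commute)
  finally show ?thesis .
qed

lemma component_connected:
  assumes "C \<in> connected_components H" "i \<in> C" "j \<in> C"
  shows "(i, j) \<in> {(i, j). {i, j} \<in> H}\<^sup>*"
proof -
  have sym: "sym ({(i, j). {i, j} \<in> H}\<^sup>*)"
    by (intro sym_rtrancl) (auto simp: sym_def insert_commute)
  obtain v where v: "(v, i) \<in> {(i, j). {i, j} \<in> H}\<^sup>*" "(v, j) \<in> {(i, j). {i, j} \<in> H}\<^sup>*"
    using assms by (auto simp: connected_components_def quotient_def)
  show ?thesis using symD[OF sym v(1)] v(2) by (rule rtrancl_trans)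
qed

lemma trivial_on_components_if_crossing_gap:
  fixes y :: "'n::finite \<Rightarrow> real ^ 'd"
  assumes small: "(\<Sum>k\<in>UNIV. crossing_gap (neighborhood \<epsilon> E y) (\<lambda>i. y i $ k)) \<le> \<delta>"
    and C: "C \<in> connected_components (profile \<epsilon> E y)"
  shows "trivial_on \<delta> y C"
  unfolding trivial_on_def
proof (intro ballI)
  fix i j assume ij: "i \<in> C" "j \<in> C"
  define N where "N = neighborhood \<epsilon> E y"
  have sub: "{(i, j). {i, j} \<in> profile \<epsilon> E y} \<subseteq> {(i, j). i \<in> N j}"
    by (auto simp: N_def neighborhood_def insert_commute)
  have conn: "(i, j) \<in> {(i, j). i \<in> N j}\<^sup>*" "(j, i) \<in> {(i, j). i \<in> N j}\<^sup>*"
    using component_connected[OF C] ij rtrancl_mono[OF sub] by blast+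
  have le: "\<bar>(y i - y j) $ k\<bar> \<le> crossing_gap N (\<lambda>i. y i $ k)" for k
    using difference_le_crossing_gap[OF conn(1), of "\<lambda>i. y i $ k"]
      difference_le_crossing_gap[OF conn(2), of "\<lambda>i. y i $ k"] by simp
  have "norm (y i - y j) \<le> (\<Sum>k\<in>UNIV. \<bar>(y i - y j) $ k\<bar>)" by (rule norm_le_l1_cart)
  also have "\<dots> \<le> (\<Sum>k\<in>UNIV. crossing_gap N (\<lambda>i. y i $ k))" by (intro sum_mono le)
  finally have "norm (y i - y j) \<le> (\<Sum>k\<in>UNIV. crossing_gap N (\<lambda>i. y i $ k))" .
  then show "norm (y i - y j) \<le> \<delta>" using small by (simp add: N_def)
qed

section \<open>Bounds for opinions and potentials\<close>

lemma averaged_bounded: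
  fixes N :: "'n::finite \<Rightarrow> 'n set"
  assumes "i \<in> N i" "a i \<in> {0..1}" and y: "\<And>k. \<bar>y k\<bar> \<le> b"
  shows "\<bar>averaged N a y i\<bar> \<le> b"
proof -
  have c: "card (N i) \<noteq> 0" using assms(1) by auto
  have "\<bar>\<Sum>k\<in>N i. y k\<bar> \<le> real (card (N i)) * b"
    using y by (intro order_trans[OF sum_abs] sum_bounded_above)
  then have s: "(1 - a i) / real (card (N i)) * \<bar>\<Sum>k\<in>N i. y k\<bar> \<le> (1 - a i) / real (card (N i)) * (real (card (N i)) * b)"
    using assms(2) by (intro mult_left_mono) auto
  have "\<bar>averaged N a y i\<bar> \<le> \<bar>a i * y i\<bar> + \<bar>(1 - a i) / real (card (N i)) * (\<Sum>k\<in>N i. y k)\<bar>"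
    unfolding averaged_def by (rule abs_triangle_ineq)
  also have "\<dots> = a i * \<bar>y i\<bar> + (1 - a i) / real (card (N i)) * \<bar>\<Sum>k\<in>N i. y k\<bar>"
    using assms(2) by (simp add: abs_mult)
  also have "\<dots> \<le> a i * b + (1 - a i) / real (card (N i)) * (real (card (N i)) * b)"
    using assms(2) y[of i] by (intro add_mono s mult_left_mono) auto
  also have "\<dots> = b" using c by (simp add: field_simps)
  finally show ?thesis .
qed

lemma potential_bounded:
  fixes y :: "'n::finite \<Rightarrow> real"
  assumes \<beta>: "0 \<le> \<beta>" "\<beta> \<le> 1" and y: "\<And>i. \<bar>y i\<bar> \<le> b"
  shows "\<bar>potential \<beta> y\<bar> \<le> real CARD('n) * b"
proof -
  have "potential \<beta> y \<in> (\<lambda>l. \<Sum>k<CARD('n). \<beta> ^ k * y (l ! k)) ` enumerations"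
    unfolding potential_def using ex_sorted_enumeration[of y]
    by (intro Min_in) (auto simp: finite_enumerations)
  then obtain l where "potential \<beta> y = (\<Sum>k<CARD('n). \<beta> ^ k * y (l ! k))" by blast
  also have "\<bar>\<dots>\<bar> \<le> (\<Sum>k<CARD('n). \<bar>\<beta> ^ k * y (l ! k)\<bar>)" by (rule sum_abs)
  also have "\<dots> \<le> real (card {..<CARD('n)}) * b"
  proof (rule sum_bounded_above)
    fix k
    have "\<bar>\<beta> ^ k * y (l ! k)\<bar> \<le> 1 * b"
      unfolding abs_mult using \<beta> y by (intro mult_mono) (auto simp: power_le_one)
    then show "\<bar>\<beta> ^ k * y (l ! k)\<bar> \<le> b" by simp
  qed
  finally show ?thesis by simp
qed

lemma gap_bounded:
  fixes y :: "'n::finite \<Rightarrow> real"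
  assumes Z: "Z \<in> cuts" and y: "\<And>i. \<bar>y i\<bar> \<le> b"
  shows "gap y Z \<le> 2 * b"
proof -
  have ne: "Z \<noteq> {}" "- Z \<noteq> {}" using Z by (auto simp: cuts_def)
  have "Max (y ` Z) \<in> y ` Z" "Min (y ` (- Z)) \<in> y ` (- Z)" using ne by (auto intro!: Max_in Min_in)
  then obtain i j where "Max (y ` Z) = y i" "Min (y ` (- Z)) = y j" by auto
  then show ?thesis using y[of i] y[of j] by (auto simp: gap_def max_def)
qed

section \<open>Measurability of the opinions\<close>

lemma measurable_mem_neighborhood:
  fixes y :: "'n::finite \<Rightarrow> 'w \<Rightarrow> real ^ 'd"
  assumes [measurable]: "\<And>i. y i \<in> borel_measurable N"
  shows "Measurable.pred N (\<lambda>\<omega>. k \<in> neighborhood \<epsilon> E (\<lambda>i. y i \<omega>) i)"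
proof -
  have "k \<in> neighborhood \<epsilon> E z i \<longleftrightarrow> k = i \<or> {i, k} \<in> E \<and> i \<noteq> k \<and> norm (z i - z k) \<le> \<epsilon>" for z :: "'n \<Rightarrow> real ^ 'd"
    by (auto simp: neighborhood_def profile_def opinion_graph_def doubleton_eq_iff norm_minus_commute)
  then show ?thesis by simp
qed

lemma measurable_HK_update:
  fixes y :: "'n::finite \<Rightarrow> 'w \<Rightarrow> real ^ 'd"
  assumes [measurable]: "\<And>i. y i \<in> borel_measurable N" "\<And>i. a i \<in> borel_measurable N"
  shows "(\<lambda>\<omega>. HK_update \<epsilon> E (\<lambda>j. a j \<omega>) (\<lambda>j. y j \<omega>) i) \<in> borel_measurable N"
proof -
  note [measurable] = measurable_mem_neighborhood[OF assms(1)]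
  have "HK_update \<epsilon> E c z i = c i *\<^sub>R z i
      + ((1 - c i) / (\<Sum>k\<in>UNIV. if k \<in> neighborhood \<epsilon> E z i then 1 else 0)) *\<^sub>R
        (\<Sum>k\<in>UNIV. if k \<in> neighborhood \<epsilon> E z i then z k else 0)" for c and z :: "'n \<Rightarrow> real ^ 'd"
    by (simp add: HK_update_def sum.If_cases)
  then show ?thesis by simp
qed

text \<open>
  The opinions under group interaction as a function of the whole stubbornness sequence \<open>a\<close>.
  The value at time \<open>t\<close> depends only on \<open>a 0, \<dots>, a (t - 1)\<close>, which makes it independent of
  the stubbornness at time \<open>t\<close>.
\<close>
primrec trajectory ::
  "real \<Rightarrow> (nat \<Rightarrow> 'n::finite set set) \<Rightarrow> ('n \<Rightarrow> real ^ 'd) \<Rightarrow> (nat \<Rightarrow> 'n \<Rightarrow> real) \<Rightarrow> nat \<Rightarrow> 'n \<Rightarrow> real ^ 'd"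
  where
  "trajectory \<epsilon> E x0 a 0 = x0"
| "trajectory \<epsilon> E x0 a (Suc t) = HK_update \<epsilon> (E t) (a t) (trajectory \<epsilon> E x0 a t)"

lemma trajectory_cong:
  "(\<And>s. s < t \<Longrightarrow> a s = a' s) \<Longrightarrow> trajectory \<epsilon> E x0 a t = trajectory \<epsilon> E x0 a' t"
  by (induction t) auto

lemma measurable_trajectory:
  assumes "\<And>s j. s < t \<Longrightarrow> (\<lambda>\<omega>. a \<omega> s j) \<in> borel_measurable N"
  shows "(\<lambda>\<omega>. trajectory \<epsilon> E x0 (a \<omega>) t i) \<in> borel_measurable N"
  using assms
proof (induction t arbitrary: i)
  case (Suc t)
  then show ?case
    using measurable_HK_update[of "\<lambda>i \<omega>. trajectory \<epsilon> E x0 (a \<omega>) t i" N "\<lambda>j \<omega>. a \<omega> t j" \<epsilon> "E t" i] by simp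
qed simp

lemma trajectory_bounded:
  fixes x0 :: "'n::finite \<Rightarrow> real ^ 'd"
  assumes "\<And>s j. a s j \<in> {0..1}" "\<And>j. \<bar>x0 j $ k\<bar> \<le> b"
  shows "\<bar>trajectory \<epsilon> E x0 a t i $ k\<bar> \<le> b"
proof (induction t arbitrary: i)
  case (Suc t)
  show ?case unfolding trajectory.simps HK_update_nth
    using assms Suc by (intro averaged_bounded neighborhood_refl) auto
qed (simp add: assms)

lemma measurable_gap:
  fixes y :: "'n::finite \<Rightarrow> 'w \<Rightarrow> real"
  assumes [measurable]: "\<And>i. y i \<in> borel_measurable N"
  shows "(\<lambda>\<omega>. gap (\<lambda>i. y i \<omega>) Z) \<in> borel_measurable N"
  unfolding gap_def by measurable

lemma measurable_potential:
  fixes y :: "'n::finite \<Rightarrow> 'w \<Rightarrow> real"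
  assumes [measurable]: "\<And>i. y i \<in> borel_measurable N"
  shows "(\<lambda>\<omega>. potential \<beta> (\<lambda>i. y i \<omega>)) \<in> borel_measurable N"
  unfolding potential_def
  by (intro borel_measurable_Min finite_enumerations) measurable

lemma measurable_mem_lower_boundary:
  fixes y :: "'n::finite \<Rightarrow> 'w \<Rightarrow> real ^ 'd"
  assumes "\<And>i. y i \<in> borel_measurable N"
  shows "Measurable.pred N (\<lambda>\<omega>. j \<in> lower_boundary (neighborhood \<epsilon> E (\<lambda>i. y i \<omega>)) Z)"
proof -
  note [measurable] = measurable_mem_neighborhood[OF assms]
  have "j \<in> lower_boundary (neighborhood \<epsilon> E z) Z \<longleftrightarrow> j \<in> Z \<and> (\<exists>i. i \<in> neighborhood \<epsilon> E z j \<and> i \<notin> Z)"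
    for z :: "'n \<Rightarrow> real ^ 'd"
    by (auto simp: lower_boundary_def)
  then show ?thesis by simp
qed

lemma measurable_nested_component:
  "s \<in> I \<Longrightarrow> (\<lambda>a. a s j) \<in> borel_measurable (PiM I (\<lambda>_. PiM UNIV (\<lambda>_. borel)))"
  using measurable_compose[OF measurable_component_singleton[of s I "\<lambda>_. PiM UNIV (\<lambda>_. borel)"]
      measurable_component_singleton[of j UNIV "\<lambda>_. borel"]] by simp

lemma measurable_coordinate:
  assumes "f \<in> borel_measurable N"
  shows "(\<lambda>\<omega>. (f \<omega> :: real ^ 'd) $ k) \<in> borel_measurable N"
  by (rule measurable_compose[OF assms borel_measurable_continuous_onI]) (intro continuous_intros)

section \<open>Growth of the expected potential under group interaction\<close>

text \<open>
  The base of the weights is chosen so that the expected gain \<open>p (1 - c) / n\<^sup>2 * \<beta> ^ (m - 1)\<close> of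
  a crossed cut with \<open>m\<close> agents below is twice the largest possible loss \<open>n * \<beta> ^ m\<close>, where
  \<open>n\<close> is the number of agents.
\<close>
lemma weight_base_bounds:
  fixes p c :: real
  assumes "0 < p" "p \<le> 1" "0 \<le> c" "c < 1"
  shows "0 < p * (1 - c) / (2 * real CARD('n::finite) ^ 3)"
    and "p * (1 - c) / (2 * real CARD('n) ^ 3) \<le> 1"
proof -
  have "1 \<le> real CARD('n) ^ 3" by (intro one_le_power) (simp add: Suc_leI)
  moreover have "p * (1 - c) \<le> 1" using assms by (intro mult_le_one) auto
  ultimately have "p * (1 - c) \<le> 2 * real CARD('n) ^ 3" by linarith
  then show "p * (1 - c) / (2 * real CARD('n) ^ 3) \<le> 1" by (simp add: divide_le_eq)
  show "0 < p * (1 - c) / (2 * real CARD('n) ^ 3)" using assms by simp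
qed

context prob_space
begin

lemma indep_expectation_times_indicator:
  fixes A :: "nat \<Rightarrow> 'a \<Rightarrow> 'n::finite \<Rightarrow> real"
  assumes ind: "indep_vars (\<lambda>_. PiM UNIV (\<lambda>_. borel)) A UNIV"
    and F: "F \<in> borel_measurable (PiM {..<t} (\<lambda>_. PiM UNIV (\<lambda>_. borel)))"
    and int: "integrable M (\<lambda>\<omega>. F (restrict (\<lambda>s. A s \<omega>) {..<t}))"
  shows "integrable M (\<lambda>\<omega>. F (restrict (\<lambda>s. A s \<omega>) {..<t}) * indicator {..c} (A t \<omega> j))"
    and "expectation (\<lambda>\<omega>. F (restrict (\<lambda>s. A s \<omega>) {..<t}) * indicator {..c} (A t \<omega> j))
       = expectation (\<lambda>\<omega>. F (restrict (\<lambda>s. A s \<omega>) {..<t})) * prob {\<omega> \<in> space M. A t \<omega> j \<le> c}"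
proof -
  have [measurable]: "A s \<in> measurable M (PiM UNIV (\<lambda>_. borel))" for s
    using ind by (auto simp: indep_vars_def)
  have "indep_var borel (F \<circ> (\<lambda>\<omega>. restrict (\<lambda>s. A s \<omega>) {..<t}))
          borel ((\<lambda>b. indicator {..c} (b t j) :: real) \<circ> (\<lambda>\<omega>. restrict (\<lambda>s. A s \<omega>) {t}))"
    by (rule indep_var_compose[OF indep_var_restrict[OF ind] F])
      (auto intro!: measurable_compose[OF measurable_nested_component] borel_measurable_indicator)
  then have iv: "indep_var borel (\<lambda>\<omega>. F (restrict (\<lambda>s. A s \<omega>) {..<t}))
          borel (\<lambda>\<omega>. indicator {..c} (A t \<omega> j) :: real)"
    by (simp add: o_def)
  have int': "integrable M (\<lambda>\<omega>. indicator {..c} (A t \<omega> j) :: real)"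
    by (intro integrable_const_bound[where B=1]) auto
  show "integrable M (\<lambda>\<omega>. F (restrict (\<lambda>s. A s \<omega>) {..<t}) * indicator {..c} (A t \<omega> j))"
    by (rule indep_var_integrable[OF iv int int'])
  have "expectation (\<lambda>\<omega>. indicator {..c} (A t \<omega> j) :: real) = expectation (indicator {\<omega> \<in> space M. A t \<omega> j \<le> c})"
    by (intro Bochner_Integration.integral_cong) (auto simp: indicator_def)
  also have "\<dots> = prob {\<omega> \<in> space M. A t \<omega> j \<le> c}" by simp
  finally show "expectation (\<lambda>\<omega>. F (restrict (\<lambda>s. A s \<omega>) {..<t}) * indicator {..c} (A t \<omega> j))
       = expectation (\<lambda>\<omega>. F (restrict (\<lambda>s. A s \<omega>) {..<t})) * prob {\<omega> \<in> space M. A t \<omega> j \<le> c}"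
    unfolding indep_var_lebesgue_integral[OF iv int int'] by simp
qed

text \<open>
  The pathwise bound is a sum of products of a gap, determined by the past, with a factor determined
  by the present stubbornness of one agent. Taking expectations replaces this factor by at least
  \<open>p * \<kappa> - \<tau>\<close>, with \<open>\<kappa>\<close> the gain and \<open>\<tau>\<close> the loss of the cut, and the choice of
  \<open>\<beta>\<close> makes this at least \<open>\<beta> ^ CARD('n)\<close> for every cut.
\<close>
lemma expected_potential_increase:
  fixes A :: "nat \<Rightarrow> 'a \<Rightarrow> 'n::finite \<Rightarrow> real" and x0 :: "'n \<Rightarrow> real ^ 'd"
    and E :: "nat \<Rightarrow> 'n set set" and \<epsilon> :: real
  assumes ind: "indep_vars (\<lambda>_. PiM UNIV (\<lambda>_. borel)) A UNIV"
    and A01: "\<And>s \<omega> j. \<omega> \<in> space M \<Longrightarrow> A s \<omega> j \<in> {0..1}"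
    and c: "0 \<le> c" "c < 1" and p: "0 < p" "p \<le> 1" "\<And>j. p \<le> prob {\<omega> \<in> space M. A t \<omega> j \<le> c}"
    and \<beta>: "\<beta> = p * (1 - c) / (2 * real CARD('n) ^ 3)"
  defines "X \<equiv> \<lambda>s \<omega>. trajectory \<epsilon> E x0 (\<lambda>r. A r \<omega>) s"
  shows "integrable M (\<lambda>\<omega>. crossing_gap (neighborhood \<epsilon> (E t) (X t \<omega>)) (\<lambda>i. X t \<omega> i $ k))" (is ?int)
    and "expectation (\<lambda>\<omega>. potential \<beta> (\<lambda>i. X t \<omega> i $ k))
         + \<beta> ^ CARD('n) * expectation (\<lambda>\<omega>. crossing_gap (neighborhood \<epsilon> (E t) (X t \<omega>)) (\<lambda>i. X t \<omega> i $ k))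
       \<le> expectation (\<lambda>\<omega>. potential \<beta> (\<lambda>i. X (Suc t) \<omega> i $ k))" (is ?incr)
proof -
  define n where "n = real CARD('n)"
  have n1: "1 \<le> n" by (simp add: n_def Suc_leI)
  have \<beta>0: "0 < \<beta>" and \<beta>1: "\<beta> \<le> 1"
    unfolding \<beta> by (rule weight_base_bounds[OF p(1,2) c])+
  have \<beta>n: "2 * n ^ 3 * \<beta> = p * (1 - c)" using n1 by (simp add: \<beta> n_def)
  define b where "b = (\<Sum>j\<in>UNIV. \<bar>x0 j $ k\<bar>)"
  have b: "\<bar>x0 j $ k\<bar> \<le> b" for j
    unfolding b_def by (rule member_le_sum) auto
  have Xb: "\<bar>X s \<omega> i $ k\<bar> \<le> b" if "\<omega> \<in> space M" for s \<omega> i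
    unfolding X_def using A01[OF that] b by (intro trajectory_bounded) auto
  have Am[measurable]: "A s \<in> measurable M (PiM UNIV (\<lambda>_. borel))" for s
    using ind by (auto simp: indep_vars_def)
  have Xm: "(\<lambda>\<omega>. X s \<omega> i) \<in> borel_measurable M" for s i
    unfolding X_def by (rule measurable_trajectory) measurable
  have Xkm[measurable]: "(\<lambda>\<omega>. X s \<omega> i $ k) \<in> borel_measurable M" for s i
    by (rule measurable_coordinate[OF Xm])
  have potint: "integrable M (\<lambda>\<omega>. potential \<beta> (\<lambda>i. X s \<omega> i $ k))" for s
    using Xb \<beta>0 \<beta>1
    by (intro integrable_const_bound[where B="n * b"] measurable_potential Xkm AE_I2)
       (auto simp: n_def intro!: potential_bounded)
  define F where "F Z j a = gap (\<lambda>i. trajectory \<epsilon> E x0 a t i $ k) Z *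
      (if j \<in> lower_boundary (neighborhood \<epsilon> (E t) (\<lambda>i. trajectory \<epsilon> E x0 a t i)) Z then 1 else 0)" for Z j a
  \<comment> \<open>\<open>F\<close> is a function of the stubbornness sequence, \<open>f\<close> the resulting random variable.\<close>
  define f where "f Z j \<omega> = F Z j (\<lambda>s. A s \<omega>)" for Z j \<omega>
  have F_restrict: "F Z j (restrict (\<lambda>s. A s \<omega>) {..<t}) = f Z j \<omega>" for Z j \<omega>
    unfolding f_def F_def by (subst (1 2) trajectory_cong[where a' = "\<lambda>s. A s \<omega>"]) auto
  have Fm: "F Z j \<in> borel_measurable (PiM {..<t} (\<lambda>_. PiM UNIV (\<lambda>_. borel)))" for Z j
  proof -
    have tm: "(\<lambda>a. trajectory \<epsilon> E x0 a t i) \<in> borel_measurable (PiM {..<t} (\<lambda>_. PiM UNIV (\<lambda>_. borel)))" for i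
      by (rule measurable_trajectory) (rule measurable_nested_component, simp)
    note [measurable] = measurable_gap[OF measurable_coordinate[OF tm]] measurable_mem_lower_boundary[OF tm]
    show ?thesis unfolding F_def by measurable
  qed
  have f0: "0 \<le> f Z j \<omega>" for Z j \<omega> by (simp add: f_def F_def gap_nonneg)
  have fint: "integrable M (f Z j)" if "Z \<in> cuts" for Z j
  proof (rule integrable_const_bound[where B="2 * b"])
    have "(\<lambda>\<omega>. F Z j (restrict (\<lambda>s. A s \<omega>) {..<t})) \<in> borel_measurable M"
      by (rule measurable_compose[OF _ Fm]) measurable
    then show "f Z j \<in> borel_measurable M" by (simp add: F_restrict)
    show "AE \<omega> in M. norm (f Z j \<omega>) \<le> 2 * b"
    proof (rule AE_I2)
      fix \<omega> assume \<omega>: "\<omega> \<in> space M"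
      have "0 \<le> b" using b[of undefined] by linarith
      then show "norm (f Z j \<omega>) \<le> 2 * b"
        using gap_bounded[OF that, of "\<lambda>i. X t \<omega> i $ k" b] Xb[OF \<omega>] gap_nonneg[of "\<lambda>i. X t \<omega> i $ k" Z]
        by (auto simp: f_def F_def X_def)
    qed
  qed
  have cg: "crossing_gap (neighborhood \<epsilon> (E t) (X t \<omega>)) (\<lambda>i. X t \<omega> i $ k) = (\<Sum>Z\<in>cuts. \<Sum>j\<in>UNIV. f Z j \<omega>)" for \<omega>
    unfolding crossing_gap_def f_def F_def X_def
    by (rule sum.cong[OF refl], rule sum.mono_neutral_cong_left) auto
  show ?int unfolding cg by (intro Bochner_Integration.integrable_sum fint)
  define \<kappa> where "\<kappa> Z = (1 - c) / n\<^sup>2 * \<beta> ^ (card Z - 1)" for Z :: "'n set"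
  define \<tau> where "\<tau> Z = tail_weight TYPE('n) \<beta> (card Z)" for Z :: "'n set"
  have margin: "\<beta> ^ CARD('n) \<le> p * \<kappa> Z - \<tau> Z" if Z: "Z \<in> cuts" for Z
  proof -
    have cz: "0 < card Z" "card Z \<le> CARD('n)" using Z by (auto simp: cuts_def card_gt_0_iff intro: card_mono)
    have "\<tau> Z \<le> real (card {card Z..<CARD('n)}) * \<beta> ^ card Z"
      unfolding \<tau>_def tail_weight_def using \<beta>0 \<beta>1 by (intro sum_bounded_above) (auto intro: power_decreasing)
    also have "\<dots> \<le> n * \<beta> ^ card Z" using \<beta>0 by (intro mult_right_mono) (auto simp: n_def)
    finally have 1: "\<tau> Z \<le> n * \<beta> ^ card Z" .
    have "p * \<kappa> Z = 2 * n ^ 3 * \<beta> / n\<^sup>2 * \<beta> ^ (card Z - 1)" unfolding \<beta>n by (simp add: \<kappa>_def)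
    also have "\<dots> = 2 * n * (\<beta> * \<beta> ^ (card Z - 1))" using n1 by (simp add: power2_eq_square power3_eq_cube)
    also have "\<beta> * \<beta> ^ (card Z - 1) = \<beta> ^ card Z" using cz by (simp flip: power_Suc)
    finally have 2: "p * \<kappa> Z = 2 * n * \<beta> ^ card Z" .
    have "\<beta> ^ CARD('n) \<le> \<beta> ^ card Z" using \<beta>0 \<beta>1 cz by (intro power_decreasing) auto
    also have "\<dots> \<le> n * \<beta> ^ card Z" using n1 \<beta>0 by (simp add: mult_le_cancel_right1)
    finally show ?thesis using 1 2 by linarith
  qed
  have \<kappa>0: "0 \<le> \<kappa> Z" for Z using c \<beta>0 by (simp add: \<kappa>_def)
  define h where "h Z j \<omega> = f Z j \<omega> * indicator {..c} (A t \<omega> j)" for Z j \<omega>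
  have hint: "integrable M (h Z j)"
    and hE: "expectation (h Z j) = expectation (f Z j) * prob {\<omega> \<in> space M. A t \<omega> j \<le> c}"
    if "Z \<in> cuts" for Z j
    using indep_expectation_times_indicator[OF ind Fm, of Z j c j] fint[OF that, of j]
    unfolding F_restrict h_def by auto
  have step: "potential \<beta> (\<lambda>i. X t \<omega> i $ k) + (\<Sum>Z\<in>cuts. \<Sum>j\<in>UNIV. h Z j \<omega> * \<kappa> Z - f Z j \<omega> * \<tau> Z)
      \<le> potential \<beta> (\<lambda>i. X (Suc t) \<omega> i $ k)" if \<omega>: "\<omega> \<in> space M" for \<omega>
  proof -
    define N where "N = neighborhood \<epsilon> (E t) (X t \<omega>)"
    have "(\<Sum>j\<in>UNIV. h Z j \<omega> * \<kappa> Z - f Z j \<omega> * \<tau> Z)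
        = (\<Sum>j\<in>lower_boundary N Z. gap (\<lambda>i. X t \<omega> i $ k) Z *
            ((if A t \<omega> j \<le> c then \<kappa> Z else 0) - \<tau> Z))" for Z
      by (rule sum.mono_neutral_cong_right) (auto simp: h_def f_def F_def N_def X_def algebra_simps)
    moreover have "(\<lambda>i. X (Suc t) \<omega> i $ k) = averaged N (A t \<omega>) (\<lambda>i. X t \<omega> i $ k)"
      by (simp add: X_def HK_update_nth N_def fun_eq_iff)
    moreover have "potential \<beta> (\<lambda>i. X t \<omega> i $ k) + (\<Sum>Z\<in>cuts. \<Sum>j\<in>lower_boundary N Z. gap (\<lambda>i. X t \<omega> i $ k) Z *
            ((if A t \<omega> j \<le> c then \<kappa> Z else 0) - \<tau> Z)) \<le> potential \<beta> (averaged N (A t \<omega>) (\<lambda>i. X t \<omega> i $ k))"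
      unfolding \<kappa>_def \<tau>_def n_def
      by (rule potential_averaged_ge) (use A01[OF \<omega>] \<beta>0 \<beta>1 c in \<open>auto simp: N_def neighborhood_refl intro: neighborhood_sym\<close>)
    ultimately show ?thesis by simp
  qed
  have dint: "integrable M (\<lambda>\<omega>. \<Sum>Z\<in>cuts. \<Sum>j\<in>UNIV. h Z j \<omega> * \<kappa> Z - f Z j \<omega> * \<tau> Z)"
    by (intro Bochner_Integration.integrable_sum Bochner_Integration.integrable_diff integrable_mult_left hint fint)
  have "\<beta> ^ CARD('n) * expectation (\<lambda>\<omega>. crossing_gap (neighborhood \<epsilon> (E t) (X t \<omega>)) (\<lambda>i. X t \<omega> i $ k))
      = (\<Sum>Z\<in>cuts. \<Sum>j\<in>UNIV. \<beta> ^ CARD('n) * expectation (f Z j))"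
    unfolding cg by (simp add: Bochner_Integration.integral_sum fint sum_distrib_left)
  also have "\<dots> \<le> (\<Sum>Z\<in>cuts. \<Sum>j\<in>UNIV. expectation (h Z j) * \<kappa> Z - expectation (f Z j) * \<tau> Z)"
  proof (intro sum_mono)
    fix Z :: "'n set" and j assume Z: "Z \<in> cuts"
    have E0: "0 \<le> expectation (f Z j)" using f0 by (intro Bochner_Integration.integral_nonneg) auto
    have "\<beta> ^ CARD('n) * expectation (f Z j) \<le> (p * \<kappa> Z - \<tau> Z) * expectation (f Z j)"
      by (intro mult_right_mono margin Z E0)
    also have "\<dots> \<le> (prob {\<omega> \<in> space M. A t \<omega> j \<le> c} * \<kappa> Z - \<tau> Z) * expectation (f Z j)"
      by (intro mult_right_mono diff_right_mono p \<kappa>0 E0)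
    finally show "\<beta> ^ CARD('n) * expectation (f Z j) \<le> expectation (h Z j) * \<kappa> Z - expectation (f Z j) * \<tau> Z"
      by (simp add: hE[OF Z] algebra_simps)
  qed
  also have "\<dots> = expectation (\<lambda>\<omega>. \<Sum>Z\<in>cuts. \<Sum>j\<in>UNIV. h Z j \<omega> * \<kappa> Z - f Z j \<omega> * \<tau> Z)"
    by (simp add: Bochner_Integration.integral_sum Bochner_Integration.integral_diff hint fint)
  finally have "expectation (\<lambda>\<omega>. potential \<beta> (\<lambda>i. X t \<omega> i $ k))
         + \<beta> ^ CARD('n) * expectation (\<lambda>\<omega>. crossing_gap (neighborhood \<epsilon> (E t) (X t \<omega>)) (\<lambda>i. X t \<omega> i $ k))
      \<le> expectation (\<lambda>\<omega>. potential \<beta> (\<lambda>i. X t \<omega> i $ k) + (\<Sum>Z\<in>cuts. \<Sum>j\<in>UNIV. h Z j \<omega> * \<kappa> Z - f Z j \<omega> * \<tau> Z))"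
    by (simp add: Bochner_Integration.integral_add[OF potint dint])
  also have "\<dots> \<le> expectation (\<lambda>\<omega>. potential \<beta> (\<lambda>i. X (Suc t) \<omega> i $ k))"
    by (intro integral_mono Bochner_Integration.integrable_add potint dint step)
  finally show ?incr .
qed

text \<open>
  The opinions stay in the box spanned by the initial ones, so the expected potentials are bounded.
  If the crossing gaps exceeded \<open>\<delta>\<close> forever with positive probability, the expected potentials
  would grow at least linearly.
\<close>
lemma AE_crossing_gaps_small:
  fixes A :: "nat \<Rightarrow> 'a \<Rightarrow> 'n::finite \<Rightarrow> real" and x0 :: "'n \<Rightarrow> real ^ 'd"
    and E :: "nat \<Rightarrow> 'n set set" and \<epsilon> :: real
  assumes ind: "indep_vars (\<lambda>_. PiM UNIV (\<lambda>_. borel)) A UNIV"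
    and A01: "\<And>s \<omega> j. \<omega> \<in> space M \<Longrightarrow> A s \<omega> j \<in> {0..1}"
    and c: "0 \<le> c" "c < 1" and p: "0 < p" "\<And>t j. p \<le> prob {\<omega> \<in> space M. A t \<omega> j \<le> c}"
    and \<delta>: "0 < \<delta>"
  defines "X \<equiv> \<lambda>s \<omega>. trajectory \<epsilon> E x0 (\<lambda>r. A r \<omega>) s"
  shows "AE \<omega> in M. \<exists>t. (\<Sum>k\<in>UNIV. crossing_gap (neighborhood \<epsilon> (E t) (X t \<omega>)) (\<lambda>i. X t \<omega> i $ k)) \<le> \<delta>"
proof -
  have p1: "p \<le> 1" using p(2)[of 0 undefined] prob_le_1 by (rule order_trans)
  define \<beta> where "\<beta> = p * (1 - c) / (2 * real CARD('n) ^ 3)"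
  have \<beta>0: "0 < \<beta>" and \<beta>1: "\<beta> \<le> 1"
    unfolding \<beta>_def by (rule weight_base_bounds[OF p(1) p1 c])+
  define g where "g k t \<omega> = crossing_gap (neighborhood \<epsilon> (E t) (X t \<omega>)) (\<lambda>i. X t \<omega> i $ k)" for k t \<omega>
  define V where "V k t = expectation (\<lambda>\<omega>. potential \<beta> (\<lambda>i. X t \<omega> i $ k))" for k t
  have gint: "integrable M (g k t)" for k t
    unfolding g_def[abs_def] X_def
    by (rule expected_potential_increase(1)[OF ind A01 c p(1) p1 p(2) \<beta>_def])
  have incr: "V k t + \<beta> ^ CARD('n) * expectation (g k t) \<le> V k (Suc t)" for k t
    unfolding V_def g_def[abs_def] X_def
    by (rule expected_potential_increase(2)[OF ind A01 c p(1) p1 p(2) \<beta>_def])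
  define b where "b k = (\<Sum>j\<in>UNIV. \<bar>x0 j $ k\<bar>)" for k
  have Am[measurable]: "A s \<in> measurable M (PiM UNIV (\<lambda>_. borel))" for s
    using ind by (auto simp: indep_vars_def)
  have Vb: "\<bar>V k t\<bar> \<le> real CARD('n) * b k" for k t
  proof -
    have "\<bar>x0 j $ k\<bar> \<le> b k" for j
      unfolding b_def by (rule member_le_sum) auto
    then have Xb: "\<bar>X t \<omega> i $ k\<bar> \<le> b k" if "\<omega> \<in> space M" for \<omega> i
      unfolding X_def using A01[OF that] by (intro trajectory_bounded) auto
    have "\<bar>V k t\<bar> \<le> expectation (\<lambda>\<omega>. \<bar>potential \<beta> (\<lambda>i. X t \<omega> i $ k)\<bar>)"
      unfolding V_def by (rule integral_abs_bound)
    also have "\<dots> \<le> expectation (\<lambda>\<omega>. real CARD('n) * b k)"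
    proof (rule integral_mono_AE')
      show "AE \<omega> in M. \<bar>potential \<beta> (\<lambda>i. X t \<omega> i $ k)\<bar> \<le> real CARD('n) * b k"
        using Xb \<beta>0 \<beta>1 by (intro AE_I2 potential_bounded) auto
    qed (auto simp: b_def sum_nonneg)
    finally show ?thesis by (simp add: prob_space)
  qed
  have telescoped: "V k 0 + \<beta> ^ CARD('n) * (\<Sum>t<T. expectation (g k t)) \<le> V k T" for k T
  proof (induction T)
    case (Suc T)
    then show ?case using incr[of k T] by (simp add: distrib_left)
  qed simp
  define bad where "bad = {\<omega> \<in> space M. \<forall>t. \<delta> < (\<Sum>k\<in>UNIV. g k t \<omega>)}"
  have gm[measurable]: "g k t \<in> borel_measurable M" for k t using gint by blast
  have [measurable]: "bad \<in> events" unfolding bad_def by measurable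
  have "prob bad = 0"
  proof (rule ccontr)
    assume "prob bad \<noteq> 0"
    then have pos: "0 < prob bad" using measure_nonneg[of M bad] by linarith
    define D where "D = \<beta> ^ CARD('n) * (\<delta> * prob bad)"
    have D: "0 < D" using pos \<delta> \<beta>0 by (simp add: D_def)
    have lower: "\<delta> * prob bad \<le> (\<Sum>k\<in>UNIV. expectation (g k t))" for t
    proof -
      have "\<delta> * prob bad = expectation (\<lambda>\<omega>. \<delta> * indicator bad \<omega>)" by simp
      also have "\<dots> \<le> expectation (\<lambda>\<omega>. \<Sum>k\<in>UNIV. g k t \<omega>)"
      proof (intro integral_mono Bochner_Integration.integrable_sum gint)
        show "integrable M (\<lambda>\<omega>. \<delta> * indicator bad \<omega>)"
          by (intro integrable_mult_right integrable_const_bound[where B = 1]) auto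
        have "0 \<le> (\<Sum>k\<in>UNIV. g k t \<omega>)" for \<omega>
          unfolding g_def by (intro sum_nonneg crossing_gap_nonneg)
        then show "\<delta> * indicator bad \<omega> \<le> (\<Sum>k\<in>UNIV. g k t \<omega>)" for \<omega>
          by (auto simp: bad_def indicator_def less_imp_le)
      qed
      also have "\<dots> = (\<Sum>k\<in>UNIV. expectation (g k t))" by (simp add: gint)
      finally show ?thesis .
    qed
    have upper: "real T * D \<le> (\<Sum>k\<in>UNIV. 2 * (real CARD('n) * b k))" for T
    proof -
      have "real T * D = \<beta> ^ CARD('n) * (\<Sum>t<T. \<delta> * prob bad)" by (simp add: D_def)
      also have "\<dots> \<le> \<beta> ^ CARD('n) * (\<Sum>t<T. \<Sum>k\<in>UNIV. expectation (g k t))"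
        using \<beta>0 by (intro mult_left_mono sum_mono lower) auto
      also have "\<dots> = (\<Sum>k\<in>UNIV. \<beta> ^ CARD('n) * (\<Sum>t<T. expectation (g k t)))"
        by (subst sum.swap) (simp add: sum_distrib_left)
      also have "\<dots> \<le> (\<Sum>k\<in>UNIV. 2 * (real CARD('n) * b k))"
      proof (rule sum_mono)
        fix k :: 'd
        show "\<beta> ^ CARD('n) * (\<Sum>t<T. expectation (g k t)) \<le> 2 * (real CARD('n) * b k)"
          using telescoped[of k T] Vb[of k T] Vb[of k 0] by linarith
      qed
      finally show ?thesis .
    qed
    obtain T where "(\<Sum>k\<in>UNIV. 2 * (real CARD('n) * b k)) < real T * D"
      using reals_Archimedean3[OF D] by blast
    then show False using upper[of T] by linarith
  qed
  then have "AE \<omega> in M. \<omega> \<notin> bad" by (simp add: prob_eq_0)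
  then show ?thesis
    by (rule AE_mp) (auto simp: bad_def g_def not_less)
qed

end

section \<open>Contraction along a matching\<close>

lemma matching_edges_unique:
  assumes "matching_in E m" "{i, j} \<in> m" "{i, k} \<in> m"
  shows "k = j" "i \<noteq> j"
proof -
  have "pairwise disjnt m" using assms(1) by (simp add: matching_in_def)
  then have "{i, j} = {i, k}" using pairwiseD[of disjnt m "{i, j}" "{i, k}"] assms(2,3) by auto
  moreover have "card {i, j} = 2" "card {i, k} = 2" using assms by (auto simp: matching_in_def)
  ultimately show "k = j" "i \<noteq> j" by (auto simp: doubleton_eq_iff)
qed

text \<open>
  Each edge of the matching contributes twice, once per orientation. The truncation at \<open>\<epsilon>\<close> bounds
  the energy independently of the opinions, and costs nothing since only pairs at distance at
  most \<open>\<epsilon>\<close> interact.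
\<close>
definition pair_energy :: "real \<Rightarrow> 'n::finite set set \<Rightarrow> ('n \<Rightarrow> real ^ 'd) \<Rightarrow> real" where
  "pair_energy \<epsilon> m y = (\<Sum>(i, j)\<in>{(i, j). {i, j} \<in> m}. min (norm (y i - y j)) \<epsilon>)"

text \<open>
  Edges of a matching do not meet, so a simple path in the profile has at most one edge.
\<close>
lemma matching_profile_component:
  assumes m: "matching_in E0 m" and C: "C \<in> connected_components (profile \<epsilon> (m \<inter> E) y)"
    and ij: "i \<in> C" "j \<in> C"
  shows "i = j \<or> {i, j} \<in> profile \<epsilon> (m \<inter> E) y"
  using component_connected[OF C ij]
proof (induction rule: rtrancl_induct)
  case (step k l)
  show ?case
  proof (cases "i = k")
    case False
    then have "{k, i} \<in> m" "{k, l} \<in> m" using step by (auto simp: profile_def insert_commute)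
    then have "l = i" by (rule matching_edges_unique(1)[OF m])
    then show ?thesis by simp
  qed (use step in auto)
qed simp

lemma HK_update_matching:
  fixes y :: "'n::finite \<Rightarrow> real ^ 'd"
  assumes m: "matching_in E0 m" and e: "{i, j} \<in> m"
  shows "HK_update \<epsilon> (m \<inter> E) a y i =
    (if {i, j} \<in> profile \<epsilon> (m \<inter> E) y then y i + ((1 - a i) / 2) *\<^sub>R (y j - y i) else y i)"
proof -
  have only: "k = j" if "{i, k} \<in> profile \<epsilon> (m \<inter> E) y" for k
    by (rule matching_edges_unique(1)[OF m e]) (use that in \<open>simp add: profile_def\<close>)
  note ne = matching_edges_unique(2)[OF m e e]
  show ?thesis
  proof (cases "{i, j} \<in> profile \<epsilon> (m \<inter> E) y")
    case True
    then have "{k. {i, k} \<in> profile \<epsilon> (m \<inter> E) y} = {j}" using only by blast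
    then have "neighborhood \<epsilon> (m \<inter> E) y i = {i, j}" by (simp add: neighborhood_def)
    then have "HK_update \<epsilon> (m \<inter> E) a y i = a i *\<^sub>R y i + ((1 - a i) / 2) *\<^sub>R (y i + y j)"
      using ne by (simp add: HK_update_def)
    also have "\<dots> = y i + ((1 - a i) / 2) *\<^sub>R (y j - y i)"
      by (simp add: vec_eq_iff field_simps)
    finally show ?thesis using True by simp
  next
    case False
    then have "{k. {i, k} \<in> profile \<epsilon> (m \<inter> E) y} = {}" using only by blast
    then have "neighborhood \<epsilon> (m \<inter> E) y i = {i}" by (simp add: neighborhood_def)
    then show ?thesis using False by (simp add: HK_update_def flip: scaleR_left_distrib)
  qed
qed

text \<open>
  An interacting pair contracts by the factor \<open>(a i + a j) / 2\<close>, which is at most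
  \<open>(1 + c) / 2\<close>; all other pairs of the matching keep their distance because neither endpoint
  moves. A component that is not \<open>\<delta>\<close>-trivial is an interacting pair at distance more than
  \<open>\<delta>\<close>.
\<close>
lemma pair_energy_decrease:
  fixes y :: "'n::finite \<Rightarrow> real ^ 'd" and a :: "'n \<Rightarrow> real"
  assumes m: "matching_in E0 m" and a: "\<And>i. a i \<in> {0..1}"
    and mob: "\<And>i j. {i, j} \<in> m \<Longrightarrow> a i \<le> c \<or> a j \<le> c" and c: "c < 1" and \<delta>: "0 < \<delta>"
    and C: "C \<in> connected_components (profile \<epsilon> (m \<inter> E) y)" "\<not> trivial_on \<delta> y C"
  shows "pair_energy \<epsilon> m (HK_update \<epsilon> (m \<inter> E) a y) \<le> pair_energy \<epsilon> m y - (1 - c) / 2 * \<delta>"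
proof -
  define H where "H = profile \<epsilon> (m \<inter> E) y"
  define z where "z = HK_update \<epsilon> (m \<inter> E) a y"
  define P where "P = {(i, j). {i, j} \<in> m}"
  define f where "f y = (\<lambda>(i, j). min (norm (y i - y j)) \<epsilon>)" for y :: "'n \<Rightarrow> real ^ 'd"
  have used: "norm (z i - z j) \<le> norm (y i - y j) - (1 - c) / 2 * norm (y i - y j)"
    if "{i, j} \<in> H" for i j
  proof -
    have ij: "{i, j} \<in> m" "{j, i} \<in> m" "{j, i} \<in> H" using that by (auto simp: H_def profile_def insert_commute)
    have "z i - z j = ((a i + a j) / 2) *\<^sub>R (y i - y j)"
      unfolding z_def HK_update_matching[OF m ij(1)] HK_update_matching[OF m ij(2)]
      using that ij by (simp add: H_def vec_eq_iff field_simps)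
    then have "norm (z i - z j) = (a i + a j) / 2 * norm (y i - y j)"
      using a[of i] a[of j] by simp
    also have "\<dots> \<le> (1 + c) / 2 * norm (y i - y j)"
      using a[of i] a[of j] mob[OF ij(1)] by (intro mult_right_mono) auto
    also have "\<dots> = norm (y i - y j) - (1 - c) / 2 * norm (y i - y j)"
      by (simp add: field_simps)
    finally show ?thesis .
  qed
  have unused: "z i - z j = y i - y j" if "{i, j} \<in> m" "{i, j} \<notin> H" for i j
    unfolding z_def HK_update_matching[OF m that(1)]
      HK_update_matching[OF m that(1)[unfolded insert_commute[of i j]]]
    using that by (simp add: H_def insert_commute)
  have shrink: "norm (z i - z j) \<le> norm (y i - y j)" if "{i, j} \<in> m" for i j
  proof (cases "{i, j} \<in> H")
    case True
    have "0 \<le> (1 - c) / 2 * norm (y i - y j)" using c by simp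
    then show ?thesis using used[OF True] by linarith
  qed (simp add: unused that)
  obtain i j where ij: "i \<in> C" "j \<in> C" "\<delta> < norm (y i - y j)"
    using C(2) by (auto simp: trivial_on_def not_le)
  then have "{i, j} \<in> H" using matching_profile_component[OF m C(1) ij(1,2)] \<delta> by (auto simp: H_def)
  then have near: "norm (y i - y j) \<le> \<epsilon>" and P: "(i, j) \<in> P"
    by (auto simp: H_def P_def profile_def opinion_graph_def doubleton_eq_iff norm_minus_commute)
  have mono: "f z q \<le> f y q" if "q \<in> P" for q
    using shrink that by (auto simp: f_def P_def intro!: min.mono)
  have drop: "f z (i, j) \<le> f y (i, j) - (1 - c) / 2 * \<delta>"
  proof -
    have "(1 - c) / 2 * \<delta> \<le> (1 - c) / 2 * norm (y i - y j)"
      using c ij by (intro mult_left_mono) auto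
    then have "norm (z i - z j) \<le> norm (y i - y j) - (1 - c) / 2 * \<delta>"
      using used[OF \<open>{i, j} \<in> H\<close>] by linarith
    then show ?thesis using near by (simp add: f_def)
  qed
  have split: "(\<Sum>q\<in>P. f w q) = f w (i, j) + (\<Sum>q\<in>P - {(i, j)}. f w q)" for w
    using P by (intro sum.remove) auto
  have "(\<Sum>q\<in>P - {(i, j)}. f z q) \<le> (\<Sum>q\<in>P - {(i, j)}. f y q)"
    by (intro sum_mono mono) auto
  then have "(\<Sum>q\<in>P. f z q) \<le> (\<Sum>q\<in>P. f y q) - (1 - c) / 2 * \<delta>"
    using drop unfolding split by linarith
  then show ?thesis by (simp add: pair_energy_def f_def P_def z_def)
qed

lemma constant_matching_run_hits:
  fixes y :: "nat \<Rightarrow> 'n::finite \<Rightarrow> real ^ 'd"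
  assumes m: "matching_in E0 m" and a: "\<And>t i. a t i \<in> {0..1}"
    and mob: "\<And>t i j. t < T \<Longrightarrow> {i, j} \<in> m \<Longrightarrow> a t i \<le> c \<or> a t j \<le> c" and c: "c < 1" and \<delta>: "0 < \<delta>"
    and \<epsilon>: "0 \<le> \<epsilon>"
    and step: "\<And>t. t < T \<Longrightarrow> y (Suc t) = HK_update \<epsilon> (m \<inter> E t) (a t) (y t)"
    and T: "real (card {(i, j). {i, j} \<in> m}) * \<epsilon> < real T * ((1 - c) / 2 * \<delta>)"
  shows "\<exists>t<T. \<forall>C\<in>connected_components (profile \<epsilon> (m \<inter> E t) (y t)). trivial_on \<delta> (y t) C"
proof (rule ccontr)
  assume *: "\<not> ?thesis"
  have "pair_energy \<epsilon> m (y t) + real t * ((1 - c) / 2 * \<delta>) \<le> pair_energy \<epsilon> m (y 0)" if "t \<le> T" for t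
    using that
  proof (induction t)
    case (Suc t)
    then have "t < T" by simp
    then obtain C where "C \<in> connected_components (profile \<epsilon> (m \<inter> E t) (y t))" "\<not> trivial_on \<delta> (y t) C"
      using * by blast
    then have "pair_energy \<epsilon> m (y (Suc t)) \<le> pair_energy \<epsilon> m (y t) - (1 - c) / 2 * \<delta>"
      unfolding step[OF Suc_le_lessD[OF Suc.prems]]
      using Suc.prems by (intro pair_energy_decrease[OF m _ _ c \<delta>] a mob) auto
    moreover have "real (Suc t) * ((1 - c) / 2 * \<delta>) = real t * ((1 - c) / 2 * \<delta>) + (1 - c) / 2 * \<delta>"
      by (simp add: field_simps)
    ultimately show ?case using Suc by linarith
  qed simp
  then have "pair_energy \<epsilon> m (y T) + real T * ((1 - c) / 2 * \<delta>) \<le> pair_energy \<epsilon> m (y 0)" by simp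
  moreover have "0 \<le> pair_energy \<epsilon> m (y T)" using \<epsilon> by (auto simp: pair_energy_def intro!: sum_nonneg)
  moreover have "pair_energy \<epsilon> m (y 0) \<le> real (card {(i, j). {i, j} \<in> m}) * \<epsilon>"
    unfolding pair_energy_def by (rule sum_bounded_above) auto
  ultimately show False using T by linarith
qed

section \<open>Long constant runs\<close>

text \<open>
  The blocks of length \<open>T\<close> after time \<open>t0\<close> are independent, and each is constantly \<open>m\<close> with
  the same probability \<open>p ^ T\<close>.
\<close>
lemma (in prob_space) AE_constant_run:
  fixes U :: "nat \<Rightarrow> 'a \<Rightarrow> 'b::countable"
  assumes ind: "indep_vars (\<lambda>_. count_space UNIV) U UNIV"
    and p: "0 < p" "\<And>t. prob {\<omega> \<in> space M. U t \<omega> = m} = p" and T: "0 < T"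
  shows "AE \<omega> in M. \<exists>s\<ge>t0. \<forall>r<T. U (s + r) \<omega> = m"
proof -
  define K where "K k = {t0 + k * T..<t0 + k * T + T}" for k
  have Um[measurable]: "U t \<in> measurable M (count_space UNIV)" for t
    using ind by (auto simp: indep_vars_def)
  have disj: "disjoint_family_on K UNIV"
  proof (unfold disjoint_family_on_def, intro ballI impI)
    have "K k \<inter> K l = {}" if "k < l" for k l
    proof -
      have "Suc k * T \<le> l * T" using that by (intro mult_right_mono) auto
      then show ?thesis by (auto simp: K_def)
    qed
    then show "K k \<inter> K l = {}" if "k \<noteq> l" for k l
      using that by (metis Int_commute linorder_neqE_nat)
  qed
  define Q where "Q k \<omega> \<longleftrightarrow> (\<forall>s\<in>K k. U s \<omega> = m)" for k \<omega>
  have indQ: "indep_vars (\<lambda>_. count_space UNIV) Q UNIV"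
  proof -
    have "indep_vars (\<lambda>k. PiM (K k) (\<lambda>_. count_space UNIV)) (\<lambda>k \<omega>. restrict (\<lambda>i. U i \<omega>) (K k)) UNIV"
      by (rule indep_vars_restrict[OF ind _ disj]) simp
    then have "indep_vars (\<lambda>_. count_space UNIV) (\<lambda>k \<omega>. \<forall>s\<in>K k. restrict (\<lambda>i. U i \<omega>) (K k) s = m) UNIV"
    proof (rule indep_vars_compose2)
      fix k
      have [measurable]: "finite (K k)" by (simp add: K_def)
      show "(\<lambda>b. \<forall>s\<in>K k. b s = m) \<in> measurable (PiM (K k) (\<lambda>_. count_space UNIV)) (count_space UNIV)"
        by measurable
    qed
    then show ?thesis by (simp add: Q_def[abs_def])
  qed
  define q where "q = p ^ T"
  have Qp: "prob {\<omega> \<in> space M. Q k \<omega>} = q" for k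
  proof -
    have "K k \<noteq> {}" "finite (K k)" using T by (auto simp: K_def)
    then have "prob (\<Inter>s\<in>K k. U s -` {m} \<inter> space M) = (\<Prod>s\<in>K k. prob (U s -` {m} \<inter> space M))"
      by (intro indep_varsD[OF ind]) auto
    also have "(\<Inter>s\<in>K k. U s -` {m} \<inter> space M) = {\<omega> \<in> space M. Q k \<omega>}"
      using \<open>K k \<noteq> {}\<close> by (auto simp: Q_def)
    also have "(\<Prod>s\<in>K k. prob (U s -` {m} \<inter> space M)) = (\<Prod>s\<in>K k. p)"
      by (intro prod.cong refl) (simp add: vimage_def Int_def conj_commute p(2))
    finally show ?thesis by (simp add: q_def K_def)
  qed
  have Qm[measurable]: "Measurable.pred M (Q k)" for k
    using indQ by (auto simp: indep_vars_def)
  have q: "0 < q" "q \<le> 1"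
    using p(1) prob_le_1[of "{\<omega> \<in> space M. Q 0 \<omega>}"] by (simp_all add: q_def Qp)
  define bad where "bad = {\<omega> \<in> space M. \<forall>k. \<not> Q k \<omega>}"
  have [measurable]: "bad \<in> events" unfolding bad_def by measurable
  have "prob bad \<le> (1 - q) ^ Suc n" for n
  proof -
    have "(\<Inter>k\<in>{..n}. Q k -` {False} \<inter> space M) = {\<omega> \<in> space M. \<forall>k\<in>{..n}. \<not> Q k \<omega>}" by auto
    then have "prob bad \<le> prob (\<Inter>k\<in>{..n}. Q k -` {False} \<inter> space M)"
      by (simp only:, intro finite_measure_mono) (auto simp: bad_def)
    also have "\<dots> = (\<Prod>k\<in>{..n}. prob (Q k -` {False} \<inter> space M))"
      by (intro indep_varsD[OF indQ]) auto
    also have "\<dots> = (\<Prod>k\<in>{..n}. 1 - q)"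
    proof (intro prod.cong refl)
      fix k
      have "Q k -` {False} \<inter> space M = {\<omega> \<in> space M. \<not> Q k \<omega>}" by auto
      then show "prob (Q k -` {False} \<inter> space M) = 1 - q" using prob_neg[of "Q k"] by (simp add: Qp)
    qed
    finally show ?thesis by simp
  qed
  moreover have "(\<lambda>n. (1 - q) ^ Suc n) \<longlonglongrightarrow> 0"
    using q by (intro LIMSEQ_Suc LIMSEQ_realpow_zero) auto
  ultimately have "prob bad \<le> 0" by (intro LIMSEQ_le_const) auto
  then have "prob bad = 0" using measure_nonneg[of M bad] by linarith
  then have "AE \<omega> in M. \<omega> \<notin> bad" by (simp add: prob_eq_0)
  then show ?thesis
  proof (rule AE_mp, intro AE_I2 impI)
    fix \<omega> assume "\<omega> \<in> space M" "\<omega> \<notin> bad"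
    then obtain k where "Q k \<omega>" by (auto simp: bad_def)
    then show "\<exists>s\<ge>t0. \<forall>r<T. U (s + r) \<omega> = m"
      by (intro exI[of _ "t0 + k * T"]) (auto simp: Q_def K_def)
  qed
qed

section \<open>Finite hitting times\<close>

lemma hitting_time_finite:
  assumes "\<forall>C\<in>connected_components (profile \<epsilon> (Eu t \<omega>) (\<lambda>i. x i t \<omega>)). trivial_on \<delta> (\<lambda>i. x i t \<omega>) C"
  shows "hitting_time \<delta> \<epsilon> Eu x \<omega> < \<infinity>"
proof -
  have "hitting_time \<delta> \<epsilon> Eu x \<omega> \<le> enat t"
    unfolding hitting_time_def using assms by (intro Inf_lower) blast
  then show ?thesis using enat_ord_simps(4) order_le_less_trans by blast
qed

lemma (in prob_space) prob_distr_eq: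
  assumes "iid M N X" "A \<in> sets N"
  shows "prob {\<omega> \<in> space M. X t \<omega> \<in> A} = prob {\<omega> \<in> space M. X 0 \<omega> \<in> A}"
proof -
  have m: "X s \<in> measurable M N" for s
    using assms(1) by (auto simp: iid_def indep_vars_def)
  have "prob {\<omega> \<in> space M. X s \<omega> \<in> A} = measure (distr M N (X s)) A" for s
    using measure_distr[OF m assms(2), of s] by (simp add: vimage_def Int_def conj_commute)
  moreover have "distr M N (X t) = distr M N (X 0)"
    using assms(1) unfolding iid_def by blast
  ultimately show ?thesis by (simp only:)
qed

text \<open>
  The event \<open>\<alpha> i 0 < 1\<close> is the increasing union of the events \<open>\<alpha> i 0 \<le> 1 - 1 / (k + 1)\<close>,
  so one of them has positive probability; finitely many agents admit a common bound, and identical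
  distribution carries it to all times.
\<close>
lemma (in prob_space) uniformly_mobile:
  fixes \<alpha> :: "'n::finite \<Rightarrow> nat \<Rightarrow> 'a \<Rightarrow> real"
  assumes iid: "\<And>i. iid M borel (\<alpha> i)" and mobile: "\<And>i. 0 < prob {\<omega> \<in> space M. \<alpha> i 0 \<omega> < 1}"
  shows "\<exists>c p. 0 \<le> c \<and> c < 1 \<and> 0 < p \<and> (\<forall>t i. p \<le> prob {\<omega> \<in> space M. \<alpha> i t \<omega> \<le> c})"
proof -
  have m[measurable]: "\<alpha> i t \<in> borel_measurable M" for i t
    using iid[of i] by (auto simp: iid_def indep_vars_def)
  have ex: "\<exists>k. 0 < prob {\<omega> \<in> space M. \<alpha> i 0 \<omega> \<le> 1 - 1 / real (Suc k)}" for i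
  proof (rule ccontr)
    assume "\<not> ?thesis"
    then have "prob {\<omega> \<in> space M. \<alpha> i 0 \<omega> \<le> 1 - 1 / real (Suc k)} = 0" for k
      using measure_nonneg order_le_less by metis
    then have "AE \<omega> in M. \<not> \<alpha> i 0 \<omega> \<le> 1 - 1 / real (Suc k)" for k
      using prob_eq_0[of "{\<omega> \<in> space M. \<alpha> i 0 \<omega> \<le> 1 - 1 / real (Suc k)}"] by simp
    then have "AE \<omega> in M. \<forall>k. \<not> \<alpha> i 0 \<omega> \<le> 1 - 1 / real (Suc k)"
      by (simp add: AE_all_countable)
    then have "AE \<omega> in M. \<omega> \<notin> {\<omega> \<in> space M. \<alpha> i 0 \<omega> < 1}"
    proof (rule AE_mp, intro AE_I2 impI)
      fix \<omega> assume *: "\<forall>k. \<not> \<alpha> i 0 \<omega> \<le> 1 - 1 / real (Suc k)"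
      have "\<not> \<alpha> i 0 \<omega> < 1"
      proof
        assume "\<alpha> i 0 \<omega> < 1"
        then obtain k where "inverse (real (Suc k)) < 1 - \<alpha> i 0 \<omega>"
          using reals_Archimedean[of "1 - \<alpha> i 0 \<omega>"] by auto
        then have "\<alpha> i 0 \<omega> \<le> 1 - 1 / real (Suc k)" by (simp add: inverse_eq_divide)
        then show False using * by blast
      qed
      then show "\<omega> \<notin> {\<omega> \<in> space M. \<alpha> i 0 \<omega> < 1}" by simp
    qed
    then have "prob {\<omega> \<in> space M. \<alpha> i 0 \<omega> < 1} = 0" by (subst prob_eq_0) auto
    then show False using mobile[of i] by simp
  qed
  then obtain K where K: "\<And>i. 0 < prob {\<omega> \<in> space M. \<alpha> i 0 \<omega> \<le> 1 - 1 / real (Suc (K i))}"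
    by metis
  define k where "k = Max (range K)"
  define c where "c = 1 - 1 / real (Suc k)"
  define p where "p = Min (range (\<lambda>i. prob {\<omega> \<in> space M. \<alpha> i 0 \<omega> \<le> c}))"
  have "0 < prob {\<omega> \<in> space M. \<alpha> i 0 \<omega> \<le> c}" for i
  proof -
    have "K i \<le> k" by (simp add: k_def)
    then have "1 - 1 / real (Suc (K i)) \<le> c" by (simp add: c_def frac_le)
    then have "prob {\<omega> \<in> space M. \<alpha> i 0 \<omega> \<le> 1 - 1 / real (Suc (K i))} \<le> prob {\<omega> \<in> space M. \<alpha> i 0 \<omega> \<le> c}"
      by (intro finite_measure_mono) auto
    then show ?thesis using K[of i] by linarith
  qed
  then have "0 < p" by (auto simp: p_def)
  moreover have "p \<le> prob {\<omega> \<in> space M. \<alpha> i t \<omega> \<le> c}" for i t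
    using prob_distr_eq[OF iid[of i], of "{..c}" t] by (simp add: p_def)
  moreover have "0 \<le> c" "c < 1" by (auto simp: c_def)
  ultimately show ?thesis by blast
qed

text \<open>
  Every agent belongs to a set that is selected with positive probability, so every agent is mobile
  and the crossing gaps of all coordinates become small together; they bound the diameters of all
  components.
\<close>
lemma group_interaction_hits:
  fixes \<alpha> :: "'n::finite \<Rightarrow> nat \<Rightarrow> 'w \<Rightarrow> real" and x0 :: "'n \<Rightarrow> real ^ 'd"
  assumes "prob_space M"
    and \<alpha>01: "\<And>i t \<omega>. \<omega> \<in> space M \<Longrightarrow> \<alpha> i t \<omega> \<in> {0..1}"
    and iid: "\<And>i. iid M borel (\<alpha> i)"
    and group: "group_interaction M \<alpha> E U S Eu"
    and init: "\<And>i \<omega>. \<omega> \<in> space M \<Longrightarrow> x i 0 \<omega> = x0 i"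
    and step: "\<And>i t \<omega>. \<omega> \<in> space M \<Longrightarrow>
           x i (Suc t) \<omega> = HK_update \<epsilon> (Eu t \<omega>) (\<lambda>j. \<alpha> j t \<omega>) (\<lambda>j. x j t \<omega>) i"
    and \<delta>: "0 < \<delta>"
  shows "AE \<omega> in M. hitting_time \<delta> \<epsilon> Eu x \<omega> < \<infinity>"
proof -
  interpret prob_space M by fact
  have Eu: "Eu t \<omega> = E t" if "\<omega> \<in> space M" for t \<omega>
    using group that by (simp add: group_interaction_def)
  have [measurable]: "\<alpha> i t \<in> borel_measurable M" for i t
    using iid[of i] by (auto simp: iid_def indep_vars_def)
  have mobile: "0 < prob {\<omega> \<in> space M. \<alpha> i 0 \<omega> < 1}" for i
  proof -
    obtain a where a: "a \<in> S" "i \<in> a" using group unfolding group_interaction_def by blast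
    then have "0 < prob {\<omega> \<in> space M. U 0 \<omega> = a}"
      using group by (auto simp: group_interaction_def discrete_support_def)
    also have "\<dots> \<le> prob {\<omega> \<in> space M. \<alpha> i 0 \<omega> < 1}"
    proof (rule finite_measure_mono)
      show "{\<omega> \<in> space M. U 0 \<omega> = a} \<subseteq> {\<omega> \<in> space M. \<alpha> i 0 \<omega> < 1}"
        using group a by (auto simp: group_interaction_def)
    qed simp
    finally show ?thesis .
  qed
  obtain c p where c: "0 \<le> c" "c < 1" and p: "0 < p" "\<And>t i. p \<le> prob {\<omega> \<in> space M. \<alpha> i t \<omega> \<le> c}"
    using uniformly_mobile[of \<alpha>, OF iid mobile] by blast
  define A where "A t \<omega> i = \<alpha> i t \<omega>" for t \<omega> i
  have ind: "indep_vars (\<lambda>_. PiM UNIV (\<lambda>_. borel)) A UNIV"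
    using group by (simp add: group_interaction_def A_def[abs_def])
  define X where "X s \<omega> = trajectory \<epsilon> E x0 (\<lambda>r. A r \<omega>) s" for s \<omega>
  have X: "(\<lambda>i. x i t \<omega>) = X t \<omega>" if "\<omega> \<in> space M" for t \<omega>
  proof (induction t)
    case 0
    then show ?case using that by (simp add: init X_def)
  next
    case (Suc t)
    then show ?case using that by (simp add: step Eu X_def A_def[abs_def] fun_eq_iff)
  qed
  have A01: "A s \<omega> j \<in> {0..1}" if "\<omega> \<in> space M" for s \<omega> j using \<alpha>01[OF that] by (simp add: A_def)
  have pA: "p \<le> prob {\<omega> \<in> space M. A t \<omega> j \<le> c}" for t j using p(2) by (simp add: A_def)
  have "AE \<omega> in M. \<exists>t. (\<Sum>k\<in>UNIV. crossing_gap (neighborhood \<epsilon> (E t) (X t \<omega>)) (\<lambda>i. X t \<omega> i $ k)) \<le> \<delta>"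
    unfolding X_def by (rule AE_crossing_gaps_small[OF ind A01 c p(1) pA \<delta>])
  then show ?thesis
  proof (rule AE_mp, intro AE_I2 impI)
    fix \<omega> assume \<omega>: "\<omega> \<in> space M"
      and "\<exists>t. (\<Sum>k\<in>UNIV. crossing_gap (neighborhood \<epsilon> (E t) (X t \<omega>)) (\<lambda>i. X t \<omega> i $ k)) \<le> \<delta>"
    then obtain t where t: "(\<Sum>k\<in>UNIV. crossing_gap (neighborhood \<epsilon> (E t) (X t \<omega>)) (\<lambda>i. X t \<omega> i $ k)) \<le> \<delta>" by blast
    show "hitting_time \<delta> \<epsilon> Eu x \<omega> < \<infinity>"
      by (rule hitting_time_finite[of _ _ t])
        (use trivial_on_components_if_crossing_gap[OF t] in \<open>simp add: Eu X \<omega>\<close>)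
  qed
qed

lemma eventually_mobile_uniformly:
  fixes \<alpha> :: "'n::finite \<Rightarrow> nat \<Rightarrow> 'w \<Rightarrow> real"
  assumes "limsup (\<lambda>t. ereal (sup_nonstubborn \<alpha> t \<omega>)) < 1"
  shows "\<exists>c t0. c < 1 \<and> (\<forall>t\<ge>t0. \<forall>i. \<alpha> i t \<omega> < 1 \<longrightarrow> \<alpha> i t \<omega> \<le> c)"
proof -
  obtain c where c: "limsup (\<lambda>t. ereal (sup_nonstubborn \<alpha> t \<omega>)) < ereal c" "ereal c < 1"
    using ereal_dense2[OF assms] by blast
  have "\<forall>\<^sub>F t in sequentially. ereal (sup_nonstubborn \<alpha> t \<omega>) < ereal c"
    by (rule Limsup_lessD[OF c(1)])
  then obtain t0 where t0: "\<And>t. t \<ge> t0 \<Longrightarrow> sup_nonstubborn \<alpha> t \<omega> < c"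
    by (auto simp: eventually_sequentially)
  have "\<alpha> i t \<omega> \<le> c" if "t \<ge> t0" "\<alpha> i t \<omega> < 1" for i t
  proof -
    have "\<alpha> i t \<omega> \<le> sup_nonstubborn \<alpha> t \<omega>"
      unfolding sup_nonstubborn_def using that by (intro cSup_upper bdd_above_finite) auto
    then show ?thesis using t0[OF that(1)] by linarith
  qed
  then show ?thesis using c(2) by auto
qed

text \<open>
  Almost surely some \<open>c < 1\<close> eventually bounds the stubbornness of all agents that move, and a
  matching \<open>m\<close> of positive probability is selected \<open>T\<close> times in a row after that moment. As
  \<open>c\<close> is random, so is the required \<open>T\<close>; hence runs of all lengths after all times are
  provided before \<open>\<omega>\<close> is fixed.
\<close>
lemma pair_interaction_hits:
  fixes \<alpha> :: "'n::finite \<Rightarrow> nat \<Rightarrow> 'w \<Rightarrow> real" and x :: "'n \<Rightarrow> nat \<Rightarrow> 'w \<Rightarrow> real ^ 'd"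
  assumes "prob_space M" and \<epsilon>: "0 < \<epsilon>"
    and \<alpha>01: "\<And>i t \<omega>. \<omega> \<in> space M \<Longrightarrow> \<alpha> i t \<omega> \<in> {0..1}"
    and pair: "pair_interaction M \<alpha> E U S Eu"
    and step: "\<And>i t \<omega>. \<omega> \<in> space M \<Longrightarrow>
           x i (Suc t) \<omega> = HK_update \<epsilon> (Eu t \<omega>) (\<lambda>j. \<alpha> j t \<omega>) (\<lambda>j. x j t \<omega>) i"
    and limsup: "AE \<omega> in M. limsup (\<lambda>t. ereal (sup_nonstubborn \<alpha> t \<omega>)) < 1"
    and \<delta>: "0 < \<delta>"
  shows "AE \<omega> in M. hitting_time \<delta> \<epsilon> Eu x \<omega> < \<infinity>"
proof -
  interpret prob_space M by fact
  have iid: "iid M (count_space UNIV) U" and supp: "\<And>t. discrete_support M (U t) = S"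
    and Eu: "\<And>t \<omega>. \<omega> \<in> space M \<Longrightarrow> Eu t \<omega> = U t \<omega> \<inter> E t"
    using pair by (simp_all add: pair_interaction_def)
  have "S \<noteq> {}"
  proof
    assume "S = {}"
    then have "AE \<omega> in M. False" using pair by (simp add: pair_interaction_def)
    then show False by simp
  qed
  then obtain m where "m \<in> S" by blast
  then have m: "matching_in (E 0) m" using pair by (simp add: pair_interaction_def)
  have ind: "indep_vars (\<lambda>_. count_space UNIV) U UNIV" using iid by (simp add: iid_def)
  define p where "p = prob {\<omega> \<in> space M. U 0 \<omega> = m}"
  have p: "0 < p" using \<open>m \<in> S\<close> supp[of 0] by (auto simp: p_def discrete_support_def)
  have pU: "prob {\<omega> \<in> space M. U t \<omega> = m} = p" for t
    using prob_distr_eq[OF iid, of "{m}" t] by (simp add: p_def)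
  have "AE \<omega> in M. \<exists>s\<ge>t0. \<forall>r<T. U (s + r) \<omega> = m" for t0 T
  proof (cases "0 < T")
    case True
    then show ?thesis by (rule AE_constant_run[OF ind p pU])
  qed auto
  then have runs: "AE \<omega> in M. \<forall>t0 T. \<exists>s\<ge>t0. \<forall>r<T. U (s + r) \<omega> = m"
    by (simp add: AE_all_countable)
  have "AE \<omega> in M. \<forall>t. \<forall>i j. {i, j} \<in> U t \<omega> \<longrightarrow> \<alpha> i t \<omega> < 1 \<or> \<alpha> j t \<omega> < 1"
    using pair by (simp add: pair_interaction_def AE_all_countable)
  with runs limsup AE_space show ?thesis
  proof eventually_elim
    case (elim \<omega>)
    then have \<omega>: "\<omega> \<in> space M" by blast
    obtain c t0 where c: "c < 1" and t0: "\<And>t i. t0 \<le> t \<Longrightarrow> \<alpha> i t \<omega> < 1 \<Longrightarrow> \<alpha> i t \<omega> \<le> c"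
      using eventually_mobile_uniformly[of \<alpha> \<omega>] elim by blast
    have "0 < (1 - c) / 2 * \<delta>" using c \<delta> by simp
    then obtain T where T: "real (card {(i, j). {i, j} \<in> m}) * \<epsilon> < real T * ((1 - c) / 2 * \<delta>)"
      using reals_Archimedean3 by blast
    obtain s where s: "t0 \<le> s" and run: "\<And>r. r < T \<Longrightarrow> U (s + r) \<omega> = m"
      using elim by blast
    have Eu_run: "Eu (s + r) \<omega> = m \<inter> E (s + r)" if "r < T" for r
      using Eu[OF \<omega>] run[OF that] by simp
    have "\<exists>t<T. \<forall>C\<in>connected_components (profile \<epsilon> (m \<inter> E (s + t)) (\<lambda>i. x i (s + t) \<omega>)).
        trivial_on \<delta> (\<lambda>i. x i (s + t) \<omega>) C"
    proof (rule constant_matching_run_hits[OF m _ _ c \<delta> _ _ T])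
      show "\<alpha> i (s + t) \<omega> \<in> {0..1}" for t i using \<alpha>01[OF \<omega>] .
      show "\<alpha> i (s + t) \<omega> \<le> c \<or> \<alpha> j (s + t) \<omega> \<le> c" if "t < T" "{i, j} \<in> m" for t i j
        using elim run[OF that(1)] that(2) t0[of "s + t"] s by (metis trans_le_add1)
      show "0 \<le> \<epsilon>" using \<epsilon> by simp
      show "(\<lambda>i. x i (s + Suc t) \<omega>) =
          HK_update \<epsilon> (m \<inter> E (s + t)) (\<lambda>i. \<alpha> i (s + t) \<omega>) (\<lambda>i. x i (s + t) \<omega>)" if "t < T" for t
        using step[OF \<omega>] Eu_run[OF that] by (simp add: fun_eq_iff)
    qed
    then obtain t where "t < T" and
      "\<forall>C\<in>connected_components (profile \<epsilon> (m \<inter> E (s + t)) (\<lambda>i. x i (s + t) \<omega>)).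
        trivial_on \<delta> (\<lambda>i. x i (s + t) \<omega>) C" by blast
    then show ?case using Eu_run by (intro hitting_time_finite[of _ _ "s + t"]) simp
  qed
qed

theorem theorem5:
  fixes M :: "'w measure"
    and \<epsilon> :: real
    and E :: "nat \<Rightarrow> 'n::finite set set"
    and Eu :: "nat \<Rightarrow> 'w \<Rightarrow> 'n set set"
    and \<alpha> :: "'n \<Rightarrow> nat \<Rightarrow> 'w \<Rightarrow> real"
    and x0 :: "'n \<Rightarrow> real ^ 'd"
    and x :: "'n \<Rightarrow> nat \<Rightarrow> 'w \<Rightarrow> real ^ 'd"
  assumes "prob_space M"
    and "\<epsilon> > 0"
    and "\<And>t. edge_set (E t)"
    and "\<And>i t \<omega>. \<omega> \<in> space M \<Longrightarrow> \<alpha> i t \<omega> \<in> {0..1}"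
    and "\<And>i. iid M borel (\<alpha> i)"
    and "(\<exists>U S. group_interaction M \<alpha> E U S Eu) \<or> (\<exists>U S. pair_interaction M \<alpha> E U S Eu)"
    and "\<And>i \<omega>. \<omega> \<in> space M \<Longrightarrow> x i 0 \<omega> = x0 i"
    and "\<And>i t \<omega>. \<omega> \<in> space M \<Longrightarrow>
           x i (Suc t) \<omega> = HK_update \<epsilon> (Eu t \<omega>) (\<lambda>j. \<alpha> j t \<omega>) (\<lambda>j. x j t \<omega>) i"
    and "AE \<omega> in M. 0 \<le> limsup (\<lambda>t. ereal (sup_nonstubborn \<alpha> t \<omega>)) \<and>
                    limsup (\<lambda>t. ereal (sup_nonstubborn \<alpha> t \<omega>)) < 1"
  shows "\<forall>\<delta>>0. AE \<omega> in M. hitting_time \<delta> \<epsilon> Eu x \<omega> < \<infinity>"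
proof (intro allI impI)
  fix \<delta> :: real
  assume \<delta>: "0 < \<delta>"
  have limsup: "AE \<omega> in M. limsup (\<lambda>t. ereal (sup_nonstubborn \<alpha> t \<omega>)) < 1"
    using assms(9) by (rule AE_mp) auto
  from assms(6) show "AE \<omega> in M. hitting_time \<delta> \<epsilon> Eu x \<omega> < \<infinity>"
  proof (elim disjE exE)
    fix U S assume group: "group_interaction M \<alpha> E U S Eu"
    show ?thesis by (rule group_interaction_hits[OF assms(1,4,5) group assms(7,8) \<delta>])
  next
    fix U S assume pair: "pair_interaction M \<alpha> E U S Eu"
    show ?thesis by (rule pair_interaction_hits[OF assms(1,2,4) pair assms(8) limsup \<delta>])
  qed
qed

end
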